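(* There are two absolute constants $L_1,L_2$ such that the following holds. Let $k\ge2$ and $n,N$ be integers such that $1\le|n|\le N$ and $k\le5\log N$. Assume that $A,B\subseteq\{1,2,\ldots,N\}$ are such that $(A,B)$ is a bipartite Diophantine tuple with property $BD_k(n)$. Then either $|A|\le L_1\log\log N$ or $|B|\le(\log N)^{L_2}$.
   Context: $\mathbb{N}$ denotes the set of positive integers, and a (perfect) $k$-th power means an integer $x^k$ with $x\in\mathbb{N}$. For an integer $k\ge2$ and a nonzero integer $n$, a pair $(A,B)$ is a bipartite Diophantine tuple with property $BD_k(n)$ if $A,B\subseteq\mathbb{N}$ each have size at least $2$ and $ab+n$ is a $k$-th power for every $a\in A$, $b\in B$. $\log$ is the natural logarithm. *)

theory Defs
  imports Complex_Main
begin

text \<open>Powers are taken of positive integers only, so neither \<open>0\<close> nor a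
  negative integer is a perfect \<open>k\<close>-th power.\<close>

definition perfect_power :: "nat \<Rightarrow> int \<Rightarrow> bool" where
  "perfect_power k m \<longleftrightarrow> (\<exists>x::int. x \<ge> 1 \<and> m = x ^ k)"

text \<open>The property \<open>BD\<^sub>k(n)\<close>, meant for \<open>k \<ge> 2\<close> and \<open>n \<noteq> 0\<close>.
  The sets need not be finite, and \<open>card\<close> is \<open>0\<close> on infinite sets, whence the
  disjunctions in the size conditions.\<close>

definition bipartite_diophantine :: "nat \<Rightarrow> int \<Rightarrow> nat set \<Rightarrow> nat set \<Rightarrow> bool" where
  "bipartite_diophantine k n A B \<longleftrightarrow>
     A \<subseteq> {1..} \<and> B \<subseteq> {1..} \<and>
     (infinite A \<or> card A \<ge> 2) \<and> (infinite B \<or> card B \<ge> 2) \<and>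
     (\<forall>a\<in>A. \<forall>b\<in>B. perfect_power k (int a * int b + n))"

end

theory Submission
  imports Defs "Jordan_Normal_Form.Determinant" "HOL-Computational_Algebra.Polynomial_FPS"
    "HOL-Analysis.Generalised_Binomial_Theorem" "HOL-Analysis.Harmonic_Numbers"
begin

text \<open>Let \<open>y\<^sub>i = (a\<^sub>i b + n) powr (1/k)\<close> for \<open>r\<close> elements \<open>a\<^sub>i\<close> of \<open>A\<close>, with \<open>r\<close> minimal
  such that \<open>D = k ^ r\<close> exceeds a constant times \<open>(ln N)\<^sup>2\<close>; then \<open>D\<close> is polynomial in \<open>ln N\<close>
  because \<open>k\<close> is at most \<open>5 ln N\<close>. The \<open>D\<close> monomials in the \<open>y\<^sub>i\<close> with exponents below \<open>k\<close> are
  integers at most \<open>(2 N\<^sup>2) ^ r\<close> at every \<open>b\<close> in \<open>B\<close>, and independently of their exponents they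
  have geometrically decaying Taylor expansions on any set of \<open>b\<close> on which each \<open>a\<^sub>i b + n\<close> varies by a
  factor of at most 5/4; \<open>B\<close> splits into polylogarithmically many such sets. The pigeonhole
  principle applied to the first \<open>D div 2\<close> Taylor coefficients yields a nonzero integer combination \<open>G\<close>
  of the monomials with \<open>\<bar>G\<bar> < 1\<close>, hence \<open>G = 0\<close>, on the given set. On the other hand \<open>G\<close> has at
  most \<open>r D\<close> zeros: they are zeros of its norm, the determinant of multiplication by \<open>G\<close> on the monomial
  basis, which does not vanish because the monomials are linearly independent over the polynomials.\<close>


section \<open>Monomials in k-th roots of linear polynomials and their independence over the
  polynomials\<close>

definition exps :: "nat \<Rightarrow> nat \<Rightarrow> (nat \<Rightarrow> nat) set" where
  "exps k r = {..<r} \<rightarrow>\<^sub>E {..<k}"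

text \<open>The general codomain lets the same monomials be formed from formal power series, from
  real values and from the integer roots at a point.\<close>

definition mono_at :: "nat \<Rightarrow> (nat \<Rightarrow> 'a::comm_monoid_mult) \<Rightarrow> (nat \<Rightarrow> nat) \<Rightarrow> 'a" where
  "mono_at r y e = (\<Prod>i<r. y i ^ e i)"

lemma finite_exps [simp]: "finite (exps k r)"
  by (simp add: exps_def finite_PiE)

lemma card_exps: "card (exps k r) = k ^ r"
  by (simp add: exps_def card_PiE)

lemma exps_less: "e \<in> exps k r \<Longrightarrow> i < r \<Longrightarrow> e i < k"
  by (auto simp: exps_def PiE_def Pi_def)

lemma exps_eqI:
  assumes "e \<in> exps k r" "f \<in> exps k r" "\<And>i. i < r \<Longrightarrow> e i = f i"
  shows "e = f"
  using assms unfolding exps_def by (auto intro: PiE_ext)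

text \<open>The logarithmic derivative of \<open>p / q\<close> has integral residues.\<close>

lemma order_diff_log_deriv:
  fixes p q :: "real poly" and \<beta> m :: real and k :: nat
  assumes pq: "p \<noteq> 0" "q \<noteq> 0"
    and eq: "of_nat k * ([:-\<beta>, 1:] * \<Lambda>) * (pderiv p * q - pderiv q * p) = \<nu> * (p * q)"
    and \<nu>: "poly \<nu> \<beta> = m * poly \<Lambda> \<beta>" and nz: "poly \<Lambda> \<beta> \<noteq> 0"
  shows "real k * (real (order \<beta> p) - real (order \<beta> q)) = m"
proof -
  define X where "X = [:-\<beta>, 1:]"
  have X: "X \<noteq> 0" "pderiv X = 1" "poly X \<beta> = 0"
    by (auto simp: X_def pderiv_pCons)
  define s where "s = order \<beta> p"
  define t where "t = order \<beta> q"
  from order_decomp[OF pq(1), of \<beta>] obtain P where P: "p = X ^ s * P" "\<not> X dvd P"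
    unfolding X_def s_def by blast
  from order_decomp[OF pq(2), of \<beta>] obtain Q where Q: "q = X ^ t * Q" "\<not> X dvd Q"
    unfolding X_def t_def by blast
  have ev: "poly P \<beta> \<noteq> 0" "poly Q \<beta> \<noteq> 0"
    using P(2) Q(2) by (auto simp: X_def poly_eq_0_iff_dvd)
  have Xpow: "X * pderiv (X ^ n) = of_nat n * X ^ n" for n
    by (induction n) (simp_all add: pderiv_mult X(2) algebra_simps del: mult_pCons_left mult_pCons_right)
  have Xd: "X * pderiv (X ^ n * R) = X ^ n * (of_nat n * R + X * pderiv R)" for n and R :: "real poly"
  proof -
    have "X * pderiv (X ^ n * R) = X * pderiv (X ^ n) * R + X ^ n * (X * pderiv R)"
      by (simp add: pderiv_mult algebra_simps)
    then show ?thesis unfolding Xpow by (simp add: algebra_simps)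
  qed
  \<comment> \<open>Once \<open>X ^ (s + t)\<close> is cancelled, \<open>X\<close> still multiplies
    the derivatives of the cofactors, so evaluation at \<beta> retains only
    \<open>s - t\<close>.\<close>
  have "X ^ (s + t) * (of_nat k * \<Lambda> * ((of_nat s - of_nat t) * P * Q + X * (pderiv P * Q - pderiv Q * P)))
      = of_nat k * \<Lambda> * (X ^ t * Q * (X ^ s * (of_nat s * P + X * pderiv P))
          - X ^ s * P * (X ^ t * (of_nat t * Q + X * pderiv Q)))"
    by (simp add: power_add algebra_simps)
  also have "\<dots> = of_nat k * (X * \<Lambda>) * (pderiv p * q - pderiv q * p)"
    unfolding Xd[symmetric] P(1) Q(1) by (simp add: algebra_simps)
  also have "\<dots> = X ^ (s + t) * (\<nu> * (P * Q))"
    using eq unfolding X_def[symmetric] by (simp add: P(1) Q(1) power_add algebra_simps)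
  finally have "of_nat k * \<Lambda> * ((of_nat s - of_nat t) * P * Q + X * (pderiv P * Q - pderiv Q * P))
      = \<nu> * (P * Q)"
    using X(1) by simp
  then have "poly (of_nat k * \<Lambda> * ((of_nat s - of_nat t) * P * Q + X * (pderiv P * Q - pderiv Q * P))) \<beta>
      = poly (\<nu> * (P * Q)) \<beta>"
    by simp
  then have "real k * (real s - real t) * (poly \<Lambda> \<beta> * poly P \<beta> * poly Q \<beta>)
      = m * (poly \<Lambda> \<beta> * poly P \<beta> * poly Q \<beta>)"
    using \<nu> X(3) by (simp add: algebra_simps)
  then show ?thesis
    using ev nz by (simp add: s_def t_def)
qed

text \<open>If \<open>y i ^ k = l i\<close> and \<open>l i\<close> has slope \<open>a i\<close>,
  then \<open>k\<close> times the logarithmic derivative of the monomial is the sum of the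
  \<open>e i * a i / l i\<close>; this is that sum multiplied by the product of all
  \<open>l i\<close>.\<close>

definition log_deriv_num :: "nat \<Rightarrow> (nat \<Rightarrow> real) \<Rightarrow> (nat \<Rightarrow> real poly) \<Rightarrow> (nat \<Rightarrow> nat) \<Rightarrow> real poly" where
  "log_deriv_num r a l e = (\<Sum>i<r. [:real (e i) * a i:] * (\<Prod>j\<in>{..<r} - {i}. l j))"

lemma log_deriv_num_Suc:
  "log_deriv_num (Suc r) a l e = l r * log_deriv_num r a l e + [:real (e r) * a r:] * (\<Prod>j<r. l j)"
proof -
  have 1: "{..<Suc r} - {i} = insert r ({..<r} - {i})" if "i < r" for i
    using that by auto
  have 2: "{..<Suc r} - {r} = {..<r}" by auto
  have "(\<Sum>i<r. [:real (e i) * a i:] * (\<Prod>j\<in>{..<Suc r} - {i}. l j))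
      = (\<Sum>i<r. l r * ([:real (e i) * a i:] * (\<Prod>j\<in>{..<r} - {i}. l j)))"
    by (intro sum.cong refl) (simp only: 1 lessThan_iff, simp)
  then show ?thesis
    unfolding log_deriv_num_def by (simp add: 2 sum_distrib_left)
qed

lemma fps_deriv_root:
  fixes y :: "real fps"
  assumes "k \<ge> 1" "y ^ k = fps_of_poly l" "l = [:\<alpha>, a:]"
  shows "of_nat k * fps_of_poly l * fps_deriv y = fps_of_poly [:a:] * y"
proof -
  obtain j where j: "k = Suc j" using assms(1) by (cases k) auto
  have "fps_deriv (y ^ k) = fps_of_poly [:a:]"
    by (simp add: assms fps_of_poly_pderiv[symmetric] pderiv_pCons)
  then have "of_nat k * y ^ j * fps_deriv y = fps_of_poly [:a:]"
    using fps_deriv_power'[of y k] by (simp add: j mult_ac del: power_Suc)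
  then have "fps_of_poly [:a:] * y = of_nat k * (y ^ j * y) * fps_deriv y"
    by (simp add: algebra_simps)
  also have "y ^ j * y = fps_of_poly l"
    using assms(2) j by (simp add: mult.commute)
  finally show ?thesis by simp
qed

text \<open>Logarithmic differentiation, adding one root at a time by the product rule. Denominators
  are cleared because \<open>l i\<close> need not be a unit among the power series.\<close>

lemma fps_deriv_mono_at:
  fixes y :: "nat \<Rightarrow> real fps"
  assumes "k \<ge> 1" "\<And>i. i < r \<Longrightarrow> y i ^ k = fps_of_poly (l i)" "\<And>i. i < r \<Longrightarrow> l i = [:\<alpha> i, a i:]"
  shows "of_nat k * fps_of_poly (\<Prod>i<r. l i) * fps_deriv (mono_at r y e)
       = fps_of_poly (log_deriv_num r a l e) * mono_at r y e"
  using assms(2,3)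
proof (induction r)
  case 0
  show ?case by (simp add: mono_at_def log_deriv_num_def)
next
  case (Suc r)
  let ?L = "fps_of_poly (\<Prod>i<r. l i)" and ?m = "mono_at r y e" and ?l = "fps_of_poly (l r)"
  have IH: "of_nat k * ?L * fps_deriv ?m = fps_of_poly (log_deriv_num r a l e) * ?m"
    using Suc by simp
  have root: "of_nat k * ?l * fps_deriv (y r) = fps_of_poly [:a r:] * y r"
    using Suc.prems assms(1) by (intro fps_deriv_root) auto
  have pow: "of_nat k * ?l * fps_deriv (y r ^ e r) = fps_of_poly [:real (e r) * a r:] * y r ^ e r"
  proof (cases "e r")
    case (Suc j)
    have "of_nat k * ?l * fps_deriv (y r ^ e r) = of_nat (e r) * y r ^ j * (of_nat k * ?l * fps_deriv (y r))"
      using fps_deriv_power'[of "y r" "e r"] by (simp add: Suc mult_ac del: power_Suc)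
    also have "\<dots> = (of_nat (e r) * fps_of_poly [:a r:]) * y r ^ e r"
      unfolding root by (simp add: Suc algebra_simps)
    also have "of_nat (e r) * fps_of_poly [:a r:] = fps_of_poly [:real (e r) * a r:]"
      by (simp add: fps_of_poly_const fps_of_nat[symmetric])
    finally show ?thesis .
  qed simp
  have "of_nat k * fps_of_poly (\<Prod>i<Suc r. l i) * fps_deriv (mono_at (Suc r) y e)
     = (of_nat k * ?L * fps_deriv ?m) * (?l * y r ^ e r) + ?L * ?m * (of_nat k * ?l * fps_deriv (y r ^ e r))"
    by (simp add: mono_at_def fps_of_poly_mult algebra_simps)
  also have "\<dots> = fps_of_poly (log_deriv_num (Suc r) a l e) * mono_at (Suc r) y e"
    unfolding IH pow log_deriv_num_Suc
    by (simp add: mono_at_def fps_of_poly_mult fps_of_poly_add algebra_simps del: mult_pCons_left mult_pCons_right)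
  finally show ?case .
qed

text \<open>In a relation that differentiation cannot shorten, a quotient \<open>p e1 / p e0\<close>
  of two coefficients has the logarithmic derivative of the monomial with exponents
  \<open>e0 - e1\<close>. Its order at the zero of \<open>l i\<close> would be
  \<open>(e0 i - e1 i) / k\<close>, which is no integer if the exponents differ at \<open>i\<close>.
  The condition \<open>pair\<close> says that the \<open>l i\<close> have distinct zeros.\<close>

lemma mono_at_independent:
  fixes y :: "nat \<Rightarrow> real fps" and p :: "(nat \<Rightarrow> nat) \<Rightarrow> real poly"
  assumes k: "k \<ge> 1" and root: "\<And>i. i < r \<Longrightarrow> y i ^ k = fps_of_poly (l i)"
    and l: "\<And>i. i < r \<Longrightarrow> l i = [:\<alpha> i, a i:]" and a: "\<And>i. i < r \<Longrightarrow> a i \<noteq> 0"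
    and pair: "\<And>i j. i < r \<Longrightarrow> j < r \<Longrightarrow> i \<noteq> j \<Longrightarrow> \<alpha> i * a j \<noteq> \<alpha> j * a i"
    and S: "S \<subseteq> exps k r" and sum0: "(\<Sum>e\<in>S. fps_of_poly (p e) * mono_at r y e) = 0"
  shows "\<forall>e\<in>S. p e = 0"
  using S sum0
proof (induction "card S" arbitrary: S p rule: less_induct)
  case less
  have fin: "finite S" using less.prems(1) finite_exps finite_subset by blast
  have ynz: "y i \<noteq> 0" if "i < r" for i
    using root[OF that] l[OF that] a[OF that] k fps_of_poly_eq_iff[of "l i" 0]
    by (auto simp: power_0_left)
  have mnz: "mono_at r y e \<noteq> 0" for e
    unfolding mono_at_def using ynz by auto
  show ?case
  proof (rule ccontr)
    assume "\<not> ?thesis"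
    then obtain e1 where e1: "e1 \<in> S" "p e1 \<noteq> 0" by auto
    \<comment> \<open>A single surviving term would be a product of two nonzero power series and
      could not vanish.\<close>
    have "\<exists>e0\<in>S - {e1}. p e0 \<noteq> 0"
    proof (rule ccontr)
      assume "\<not> ?thesis"
      then have "(\<Sum>e\<in>S - {e1}. fps_of_poly (p e) * mono_at r y e) = 0"
        by (intro sum.neutral) auto
      then have "fps_of_poly (p e1) * mono_at r y e1 = 0"
        using less.prems(2) e1 fin by (simp add: sum.remove)
      then show False
        using mnz e1(2) fps_of_poly_eq_iff[of "p e1" 0] by simp
    qed
    then obtain e0 where e0: "e0 \<in> S" "e0 \<noteq> e1" "p e0 \<noteq> 0" by auto
    define \<Lambda> where "\<Lambda> = (\<Prod>i<r. l i)"
    define \<mu> where "\<mu> = log_deriv_num r a l"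
    define d where "d = (\<lambda>e. of_nat k * \<Lambda> * pderiv (p e) + \<mu> e * p e)"
    \<comment> \<open>Eliminating \<open>e0\<close> between the relation and its derivative gives a shorter relation.\<close>
    define q where "q = (\<lambda>e. d e * p e0 - d e0 * p e)"
    have dd: "of_nat k * fps_of_poly \<Lambda> * fps_deriv (fps_of_poly (p e) * mono_at r y e)
        = fps_of_poly (d e) * mono_at r y e" for e
    proof -
      have "of_nat k * fps_of_poly \<Lambda> * fps_deriv (mono_at r y e) = fps_of_poly (\<mu> e) * mono_at r y e"
        unfolding \<Lambda>_def \<mu>_def using k root l by (rule fps_deriv_mono_at)
      then have "of_nat k * fps_of_poly \<Lambda> * fps_deriv (fps_of_poly (p e) * mono_at r y e)
        = of_nat k * fps_of_poly \<Lambda> * fps_of_poly (pderiv (p e)) * mono_at r y e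
          + fps_of_poly (p e) * (fps_of_poly (\<mu> e) * mono_at r y e)"
        by (simp add: fps_of_poly_pderiv algebra_simps)
      moreover have "fps_of_poly (of_nat k :: real poly) = of_nat k"
        by (simp add: of_nat_poly fps_of_poly_const fps_of_nat)
      ultimately show ?thesis
        by (simp add: d_def fps_of_poly_mult fps_of_poly_add algebra_simps)
    qed
    have "(\<Sum>e\<in>S. fps_of_poly (d e) * mono_at r y e)
        = of_nat k * fps_of_poly \<Lambda> * fps_deriv (\<Sum>e\<in>S. fps_of_poly (p e) * mono_at r y e)"
      by (simp only: dd[symmetric] sum_distrib_left fps_deriv_sum)
    then have d0: "(\<Sum>e\<in>S. fps_of_poly (d e) * mono_at r y e) = 0"
      by (simp add: less.prems(2))
    have "(\<Sum>e\<in>S. fps_of_poly (q e) * mono_at r y e)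
       = fps_of_poly (p e0) * (\<Sum>e\<in>S. fps_of_poly (d e) * mono_at r y e)
         - fps_of_poly (d e0) * (\<Sum>e\<in>S. fps_of_poly (p e) * mono_at r y e)"
      by (simp add: q_def fps_of_poly_mult fps_of_poly_diff sum_distrib_left sum_subtractf algebra_simps)
    also have "\<dots> = 0" using d0 less.prems(2) by simp
    finally have "(\<Sum>e\<in>S - {e0}. fps_of_poly (q e) * mono_at r y e) = 0"
      using e0(1) fin by (simp add: sum.remove q_def)
    moreover have "card (S - {e0}) < card S"
      using e0(1) fin by (meson card_Diff1_less)
    ultimately have "\<forall>e\<in>S - {e0}. q e = 0"
      using less.prems(1) by (intro less.hyps) auto
    then have q1: "q e1 = 0" using e0 e1 by auto
    have "e0 \<in> exps k r" "e1 \<in> exps k r" using e0 e1 less.prems(1) by auto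
    then obtain i where i: "i < r" "e0 i \<noteq> e1 i"
      using e0(2) exps_eqI by blast
    \<comment> \<open>This is the zero of \<open>l i\<close>. By \<open>pair\<close> no other
      \<open>l j\<close> vanishes there, so \<open>\<Lambda>\<close> has a simple zero with cofactor
      \<open>\<Lambda>'\<close>.\<close>
    define \<beta> where "\<beta> = - \<alpha> i / a i"
    define \<Lambda>' where "\<Lambda>' = [:a i:] * (\<Prod>j\<in>{..<r} - {i}. l j)"
    have li: "l i = [:-\<beta>, 1:] * [:a i:]"
      using l[OF i(1)] a[OF i(1)] by (simp add: \<beta>_def)
    have \<Lambda>: "\<Lambda> = [:-\<beta>, 1:] * \<Lambda>'"
      unfolding \<Lambda>_def \<Lambda>'_def using i(1) by (simp add: prod.remove[of _ i] li mult_ac del: mult_pCons_left mult_pCons_right)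
    have li0: "poly (l i) \<beta> = 0" by (simp add: li)
    have lj: "poly (l j) \<beta> \<noteq> 0" if "j < r" "j \<noteq> i" for j
      using pair[OF that(1) i(1) that(2)] a[OF i(1)] l[OF that(1)]
      by (simp add: \<beta>_def field_simps)
    have \<Lambda>'nz: "poly \<Lambda>' \<beta> \<noteq> 0"
      unfolding \<Lambda>'_def using lj a[OF i(1)] by (simp add: poly_prod)
    have \<mu>: "poly (\<mu> e) \<beta> = real (e i) * poly \<Lambda>' \<beta>" for e
    proof -
      have "poly (\<mu> e) \<beta> = (\<Sum>m<r. real (e m) * a m * (\<Prod>j\<in>{..<r} - {m}. poly (l j) \<beta>))"
        unfolding \<mu>_def log_deriv_num_def by (simp add: poly_sum poly_prod)
      also have "\<dots> = (\<Sum>m<r. if m = i then real (e i) * a i * (\<Prod>j\<in>{..<r} - {i}. poly (l j) \<beta>) else 0)"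
        using i(1) li0 by (intro sum.cong refl) (auto intro!: prod_zero bexI[of _ i])
      also have "\<dots> = real (e i) * poly \<Lambda>' \<beta>"
        using i(1) by (simp add: \<Lambda>'_def poly_prod)
      finally show ?thesis .
    qed
    have "of_nat k * ([:-\<beta>, 1:] * \<Lambda>') * (pderiv (p e1) * p e0 - pderiv (p e0) * p e1)
        = (\<mu> e0 - \<mu> e1) * (p e1 * p e0)"
      using q1 unfolding q_def d_def \<Lambda>[symmetric] by (simp add: algebra_simps)
    \<comment> \<open>The difference of the two orders is an integer, so \<open>k\<close> divides
      \<open>e0 i - e1 i\<close>; this is impossible for distinct exponents below
      \<open>k\<close>.\<close>
    then have "real k * (real (order \<beta> (p e1)) - real (order \<beta> (p e0))) = real (e0 i) - real (e1 i)"
      using e0 e1 \<Lambda>'nz by (intro order_diff_log_deriv[where \<Lambda> = \<Lambda>' and \<nu> = "\<mu> e0 - \<mu> e1"])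
        (auto simp: \<mu> algebra_simps)
    then have "of_int (int k * (int (order \<beta> (p e1)) - int (order \<beta> (p e0)))) = (of_int (int (e0 i) - int (e1 i)) :: real)"
      by simp
    then have "int k * (int (order \<beta> (p e1)) - int (order \<beta> (p e0))) = int (e0 i) - int (e1 i)"
      by (simp only: of_int_eq_iff)
    then have "int k dvd int (e0 i) - int (e1 i)" by (metis dvd_triv_left)
    moreover have "e0 i < k" "e1 i < k"
      using exps_less i(1) \<open>e0 \<in> exps k r\<close> \<open>e1 \<in> exps k r\<close> by blast+
    ultimately have "int (e0 i) = int (e1 i)"
      by (metis mod_eq_dvd_iff mod_pos_pos_trivial of_nat_0_le_iff of_nat_less_iff)
    then show False using i(2) by simp
  qed
qed

section \<open>The norm of a combination and the number of its zeros\<close>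

text \<open>Subtraction \<open>f - e\<close> of residue vectors modulo \<open>k\<close>: the
  exponent vector that takes the monomial of \<open>e\<close> to that of \<open>f\<close>, up to
  factors \<open>l i\<close>. Adding \<open>k\<close> first avoids truncated subtraction.\<close>

definition exps_sub :: "nat \<Rightarrow> nat \<Rightarrow> (nat \<Rightarrow> nat) \<Rightarrow> (nat \<Rightarrow> nat) \<Rightarrow> nat \<Rightarrow> nat" where
  "exps_sub k r f e = restrict (\<lambda>i. (f i + k - e i) mod k) {..<r}"

text \<open>The matrix of multiplication by \<open>\<Sum>g. c g * y ^ g\<close> in the monomial basis, where the carries
  in the exponents are absorbed by \<open>y i ^ k = l i\<close>.\<close>

definition mult_entry :: "nat \<Rightarrow> nat \<Rightarrow> ((nat \<Rightarrow> nat) \<Rightarrow> real) \<Rightarrow> (nat \<Rightarrow> real poly) \<Rightarrow>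
    (nat \<Rightarrow> nat) \<Rightarrow> (nat \<Rightarrow> nat) \<Rightarrow> real poly" where
  "mult_entry k r c l e f =
     [:c (exps_sub k r f e):] * (\<Prod>i<r. l i ^ ((e i + exps_sub k r f e i) div k))"

lemma mod_add_sub_cancel:
  fixes e f :: nat
  assumes "e < k" "f < k"
  shows "(e + (f + k - e) mod k) mod k = f" "((e + f) mod k + k - e) mod k = f"
proof -
  have "(e + (f + k - e) mod k) mod k = (e + (f + k - e)) mod k" by (simp add: mod_add_right_eq)
  then show "(e + (f + k - e) mod k) mod k = f" using assms by simp
  have "((e + f) mod k + k - e) mod k = ((e + f) mod k + (k - e)) mod k" using assms by simp
  also have "\<dots> = (e + f + (k - e)) mod k" by (simp add: mod_add_left_eq)
  also have "\<dots> = f" using assms by simp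
  finally show "((e + f) mod k + k - e) mod k = f" .
qed

text \<open>Instantiated twice: with \<open>h\<close> the embedding into formal power series, and with \<open>h\<close> the
  evaluation at a point where the \<open>y i\<close> take real values.\<close>

lemma mono_at_mult:
  fixes y :: "nat \<Rightarrow> 'a::comm_ring_1" and h :: "real poly \<Rightarrow> 'a"
  assumes hm: "\<And>p q. h (p * q) = h p * h q" "h 1 = 1"
    and root: "\<And>i. i < r \<Longrightarrow> y i ^ k = h (l i)" and e: "e \<in> exps k r"
  shows "mono_at r y e * (\<Sum>g\<in>exps k r. h [:c g:] * mono_at r y g)
       = (\<Sum>f\<in>exps k r. h (mult_entry k r c l e f) * mono_at r y f)"
proof -
  have hpow: "h (p ^ n) = h p ^ n" for p n
    by (induction n) (simp_all add: hm)
  have hprod: "h (\<Prod>i<n. p i) = (\<Prod>i<n. h (p i))" for p :: "nat \<Rightarrow> real poly" and n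
    by (induction n) (simp_all add: hm)
  \<comment> \<open>Adding \<open>e\<close> modulo \<open>k\<close> permutes the exponent vectors,
    with inverse \<open>exps_sub\<close>; the sum is reindexed along this permutation.\<close>
  define add where "add = (\<lambda>g. restrict (\<lambda>i. (e i + g i) mod k) {..<r})"
  have add_in: "add g \<in> exps k r" if "g \<in> exps k r" for g
    using exps_less[OF that] by (auto simp: add_def exps_def intro: mod_less_divisor[OF le_less_trans[OF le0]])
  have sub_in: "exps_sub k r f e \<in> exps k r" if "f \<in> exps k r" for f
    using exps_less[OF that] by (auto simp: exps_sub_def exps_def intro: mod_less_divisor[OF le_less_trans[OF le0]])
  have sub_add: "exps_sub k r (add g) e = g" if "g \<in> exps k r" for g
    using exps_less[OF that] exps_less[OF e]
    by (intro exps_eqI[OF sub_in[OF add_in[OF that]] that]) (simp add: exps_sub_def add_def mod_add_sub_cancel)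
  have add_sub: "add (exps_sub k r f e) = f" if "f \<in> exps k r" for f
    using exps_less[OF that] exps_less[OF e]
    by (intro exps_eqI[OF add_in[OF sub_in[OF that]] that]) (simp add: exps_sub_def add_def mod_add_sub_cancel)
  have term_eq: "mono_at r y e * (h [:c g:] * mono_at r y g) = h (mult_entry k r c l e (add g)) * mono_at r y (add g)"
    if g: "g \<in> exps k r" for g
  proof -
    have "mono_at r y e * mono_at r y g = (\<Prod>i<r. y i ^ (e i + g i))"
      by (simp add: mono_at_def prod.distrib power_add)
    also have "\<dots> = (\<Prod>i<r. h (l i) ^ ((e i + g i) div k) * y i ^ add g i)"
    proof (intro prod.cong refl)
      fix i assume "i \<in> {..<r}"
      have "y i ^ (e i + g i) = y i ^ (k * ((e i + g i) div k) + (e i + g i) mod k)" by simp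
      then show "y i ^ (e i + g i) = h (l i) ^ ((e i + g i) div k) * y i ^ add g i"
        using \<open>i \<in> {..<r}\<close> root[of i] by (simp only: power_add power_mult add_def) simp
    qed
    also have "\<dots> = (\<Prod>i<r. h (l i) ^ ((e i + g i) div k)) * mono_at r y (add g)"
      by (simp add: mono_at_def prod.distrib)
    finally have "mono_at r y e * mono_at r y g = (\<Prod>i<r. h (l i) ^ ((e i + g i) div k)) * mono_at r y (add g)" .
    then have "mono_at r y e * (h [:c g:] * mono_at r y g)
        = h [:c g:] * ((\<Prod>i<r. h (l i) ^ ((e i + g i) div k)) * mono_at r y (add g))"
      by (metis mult.left_commute)
    then show ?thesis
      unfolding mult_entry_def sub_add[OF g] hm(1) hprod hpow by (simp only: mult.assoc)
  qed
  show ?thesis unfolding sum_distrib_left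
    by (rule sum.reindex_bij_witness[where i = "\<lambda>f. exps_sub k r f e" and j = add])
      (simp_all add: sub_add add_sub add_in sub_in term_eq)
qed

text \<open>Two exponents below \<open>k\<close> add up to less than \<open>2 * k\<close>, so each
  coordinate carries at most once and each \<open>l i\<close> enters at most to the first
  power.\<close>

lemma degree_mult_entry:
  assumes "\<And>i. i < r \<Longrightarrow> degree (l i) \<le> 1" "e \<in> exps k r"
  shows "degree (mult_entry k r c l e f) \<le> r"
proof -
  have "degree (l i ^ ((e i + exps_sub k r f e i) div k)) \<le> 1" if i: "i < r" for i
  proof -
    have "e i < k" using exps_less[OF assms(2) i] .
    then have "exps_sub k r f e i < k" using i by (simp add: exps_sub_def)
    with \<open>e i < k\<close> have "(e i + exps_sub k r f e i) div k \<le> 1"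
      by (intro less_Suc_eq_le[THEN iffD1]) (simp add: less_mult_imp_div_less)
    then have "(e i + exps_sub k r f e i) div k * degree (l i) \<le> 1"
      using assms(1)[OF i] by (metis mult_le_mono nat_mult_1)
    then show ?thesis using degree_power_le[of "l i"] by (metis le_trans mult.commute)
  qed
  then have "degree (\<Prod>i<r. l i ^ ((e i + exps_sub k r f e i) div k)) \<le> (\<Sum>i<r. 1)"
    by (intro order_trans[OF degree_prod_sum_le] sum_mono) auto
  then show ?thesis unfolding mult_entry_def
    by (intro order_trans[OF degree_mult_le]) simp
qed

lemma fps_root_exists:
  assumes "\<alpha> > 0" "k \<ge> 1"
  shows "\<exists>y :: real fps. y ^ k = fps_of_poly [:\<alpha>, a:]"
proof -
  obtain j where j: "k = Suc j" using assms(2) by (cases k) auto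
  have "fps_nth (fps_of_poly [:\<alpha>, a:]) 0 = \<alpha>" by simp
  then have "fps_radical root (Suc j) (fps_of_poly [:\<alpha>, a:]) ^ Suc j = fps_of_poly [:\<alpha>, a:]"
    using assms(1) by (intro iffD1[OF power_radical]) (auto simp: real_root_pow_pos2 simp del: power_Suc)
  then show ?thesis using j by blast
qed

text \<open>All entries of the matrix of size \<open>k ^ r\<close> have degree at most
  \<open>r\<close>, so its determinant has degree at most \<open>r * k ^ r\<close>. Positive
  \<open>\<alpha> i\<close> allow the roots to be expanded as power series at 0.\<close>

lemma card_zeros_mono_at_combination:
  fixes \<alpha> a :: "nat \<Rightarrow> real" and c :: "(nat \<Rightarrow> nat) \<Rightarrow> real" and x :: "real \<Rightarrow> nat \<Rightarrow> real"
  assumes k: "k \<ge> 1" and \<alpha>: "\<And>i. i < r \<Longrightarrow> \<alpha> i > 0" and a: "\<And>i. i < r \<Longrightarrow> a i \<noteq> 0"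
    and pair: "\<And>i j. i < r \<Longrightarrow> j < r \<Longrightarrow> i \<noteq> j \<Longrightarrow> \<alpha> i * a j \<noteq> \<alpha> j * a i"
    and c: "e1 \<in> exps k r" "c e1 \<noteq> 0"
    and root: "\<And>t i. t \<in> S \<Longrightarrow> i < r \<Longrightarrow> x t i ^ k = \<alpha> i + a i * t"
    and zero: "\<And>t. t \<in> S \<Longrightarrow> (\<Sum>e\<in>exps k r. c e * mono_at r (x t) e) = 0"
  shows "finite S \<and> card S \<le> r * k ^ r"
proof -
  define l where "l = (\<lambda>i. [:\<alpha> i, a i:])"
  define D where "D = k ^ r"
  have "\<forall>i. \<exists>y :: real fps. i < r \<longrightarrow> y ^ k = fps_of_poly (l i)"
    using fps_root_exists[OF \<alpha> k] by (metis l_def)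
  then obtain y :: "nat \<Rightarrow> real fps" where y: "\<And>i. i < r \<Longrightarrow> y i ^ k = fps_of_poly (l i)"
    by metis
  obtain idx where idx: "bij_betw idx {0..<D} (exps k r)"
    using ex_bij_betw_nat_finite[OF finite_exps[of k r]] by (auto simp: card_exps D_def)
  have idx_in: "idx m \<in> exps k r" if "m < D" for m
    using idx that by (auto simp: bij_betw_def)
  define A where "A = Matrix.mat D D (\<lambda>(m, n). mult_entry k r c l (idx m) (idx n))"
  have A: "A \<in> carrier_mat D D" by (simp add: A_def)
  have sum_idx: "(\<Sum>f\<in>exps k r. F f) = (\<Sum>n<D. F (idx n))" for F :: "(nat \<Rightarrow> nat) \<Rightarrow> 'b::comm_monoid_add"
    using sum.reindex_bij_betw[OF idx, of F] by (simp add: atLeast0LessThan)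
  note indep = mono_at_independent[where k = k and r = r and y = y and l = l and \<alpha> = \<alpha> and a = a,
      OF k y l_def[THEN fun_cong] a pair order_refl, simplified]
  have detA: "Determinant.det A \<noteq> 0"
  proof
    assume "Determinant.det A = 0"
    \<comment> \<open>A kernel vector of the transpose has polynomial entries and combines the rows
      of \<open>A\<close> to zero. Row \<open>m\<close> holds the coordinates of the
      \<open>m\<close>-th monomial times \<open>G\<close>, so the same combination \<open>U\<close>
      of monomials satisfies \<open>U * G = 0\<close>. Independence gives
      \<open>G \<noteq> 0\<close>, hence \<open>U = 0\<close>, and then independence makes the
      kernel vector zero.\<close>
    then have "Determinant.det (transpose_mat A) = 0"
      using det_transpose[OF A] by simp
    then obtain v where v: "v \<in> carrier_vec D" "v \<noteq> 0\<^sub>v D" "transpose_mat A *\<^sub>v v = 0\<^sub>v D"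
      using det_0_iff_vec_prod_zero[of "transpose_mat A" D] A by auto
    have col: "(\<Sum>m<D. mult_entry k r c l (idx m) (idx n) * vec_index v m) = 0" if n: "n < D" for n
    proof -
      have "vec_index (transpose_mat A *\<^sub>v v) n = 0" using v(3) n by simp
      then show ?thesis using n v(1) A
        by (simp add: scalar_prod_def A_def atLeast0LessThan)
    qed
    define G where "G = (\<Sum>g\<in>exps k r. fps_of_poly [:c g:] * mono_at r y g)"
    define U where "U = (\<Sum>m<D. fps_of_poly (vec_index v m) * mono_at r y (idx m))"
    have mult: "mono_at r y (idx m) * G = (\<Sum>n<D. fps_of_poly (mult_entry k r c l (idx m) (idx n)) * mono_at r y (idx n))"
      if "m < D" for m
      unfolding G_def sum_idx[symmetric, where F = "\<lambda>f. fps_of_poly (mult_entry k r c l (idx m) f) * mono_at r y f"]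
      using y idx_in[OF that] by (intro mono_at_mult) (auto simp: fps_of_poly_mult)
    have "U * G = (\<Sum>m<D. fps_of_poly (vec_index v m) * (mono_at r y (idx m) * G))"
      by (simp add: U_def sum_distrib_right mult.assoc)
    also have "\<dots> = (\<Sum>m<D. \<Sum>n<D. fps_of_poly (mult_entry k r c l (idx m) (idx n) * vec_index v m) * mono_at r y (idx n))"
      by (intro sum.cong refl, subst mult) (auto simp: sum_distrib_left fps_of_poly_mult mult_ac)
    also have "\<dots> = (\<Sum>n<D. fps_of_poly (\<Sum>m<D. mult_entry k r c l (idx m) (idx n) * vec_index v m) * mono_at r y (idx n))"
      by (subst sum.swap) (simp add: fps_of_poly_sum sum_distrib_right)
    also have "\<dots> = 0" by (intro sum.neutral) (simp add: col)
    finally have "U * G = 0" .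
    moreover have "G \<noteq> 0"
    proof
      assume "G = 0"
      then have "[:c e1:] = 0" unfolding G_def using indep[of "\<lambda>g. [:c g:]"] c(1) by blast
      then show False using c(2) by simp
    qed
    ultimately have U0: "U = 0" by simp
    define p where "p = (\<lambda>e. vec_index v (inv_into {0..<D} idx e))"
    have p: "p (idx m) = vec_index v m" if "m < D" for m
      using idx that by (simp add: p_def bij_betw_def inv_into_f_f)
    have "(\<Sum>e\<in>exps k r. fps_of_poly (p e) * mono_at r y e) = 0"
      unfolding sum_idx using U0 by (simp add: U_def p)
    then have "\<forall>e\<in>exps k r. p e = 0" using indep by blast
    then have "vec_index v m = 0" if "m < D" for m
      using p[OF that] idx_in[OF that] by metis
    then show False using v(1,2) by (auto simp: Matrix.vec_eq_iff)
  qed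
  have root_det: "poly (Determinant.det A) t = 0" if t: "t \<in> S" for t
  proof -
    interpret ev: comm_ring_hom "\<lambda>p. poly p t" by unfold_locales auto
    \<comment> \<open>The matrix evaluated at \<open>t\<close> multiplies this vector by the value
      of the combination, which is 0. The vector is nonzero because the monomial with all exponents
      0 takes the value 1.\<close>
    define w where "w = Matrix.vec D (\<lambda>n. mono_at r (x t) (idx n))"
    have "map_mat (\<lambda>p. poly p t) A *\<^sub>v w = 0\<^sub>v D"
    proof (rule eq_vecI)
      fix m assume "m < dim_vec (0\<^sub>v D)"
      then have m: "m < D" by simp
      have "mono_at r (x t) (idx m) * (\<Sum>g\<in>exps k r. poly [:c g:] t * mono_at r (x t) g)
          = (\<Sum>f\<in>exps k r. poly (mult_entry k r c l (idx m) f) t * mono_at r (x t) f)"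
        using root[OF t] by (intro mono_at_mult idx_in[OF m]) (auto simp: l_def mult.commute)
      then show "vec_index (map_mat (\<lambda>p. poly p t) A *\<^sub>v w) m = vec_index (0\<^sub>v D) m"
        using m zero[OF t] by (simp add: A_def w_def scalar_prod_def sum_idx atLeast0LessThan)
    qed (simp add: A_def)
    moreover have "w \<noteq> 0\<^sub>v D"
    proof -
      have "restrict (\<lambda>_. 0) {..<r} \<in> exps k r" using k by (auto simp: exps_def)
      also have "exps k r = idx ` {0..<D}" using idx by (simp add: bij_betw_def)
      finally obtain m where m: "m < D" "idx m = restrict (\<lambda>_. 0) {..<r}"
        by (elim imageE) auto
      have "vec_index w m = 1" using m by (simp add: w_def mono_at_def)
      then show ?thesis using m(1) by auto
    qed
    moreover have "w \<in> carrier_vec D" by (simp add: w_def)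
    ultimately have "\<exists>v. v \<in> carrier_vec D \<and> v \<noteq> 0\<^sub>v D \<and> map_mat (\<lambda>p. poly p t) A *\<^sub>v v = 0\<^sub>v D"
      by blast
    moreover have "map_mat (\<lambda>p. poly p t) A \<in> carrier_mat D D" using A by simp
    ultimately have "Determinant.det (map_mat (\<lambda>p. poly p t) A) = 0"
      using det_0_iff_vec_prod_zero by blast
    then show ?thesis using ev.hom_det[of A] by simp
  qed
  have "degree (Determinant.det A) \<le> r * D"
    using degree_mult_entry[of r l _ k c] idx_in by (intro degree_det_le[OF _ A]) (simp add: A_def l_def)
  moreover have "finite {t. poly (Determinant.det A) t = 0}" "card {t. poly (Determinant.det A) t = 0} \<le> degree (Determinant.det A)"
    using poly_roots_finite[OF detA] card_poly_roots_bound[OF detA] by auto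
  moreover have "S \<subseteq> {t. poly (Determinant.det A) t = 0}" using root_det by auto
  ultimately show ?thesis unfolding D_def by (meson card_mono finite_subset le_trans)
qed

section \<open>Taylor expansions with absolutely summable coefficients\<close>

text \<open>Bounding the sum of the absolute values of the coefficients makes the constant
  multiplicative under products. Convergence up to 1, for points that will lie in [0, 1/2], is the
  source of the geometric decay.\<close>

definition has_l1_series :: "real \<Rightarrow> (real \<Rightarrow> real) \<Rightarrow> bool" where
  "has_l1_series C f \<longleftrightarrow> (\<exists>\<kappa>. summable (\<lambda>j. \<bar>\<kappa> j\<bar>) \<and> (\<Sum>j. \<bar>\<kappa> j\<bar>) \<le> C \<and>
     (\<forall>s\<in>{0..1}. (\<lambda>j. \<kappa> j * s ^ j) sums f s))"

lemma has_l1_series_one: "has_l1_series 1 (\<lambda>_. 1)"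
proof -
  define \<kappa> :: "nat \<Rightarrow> real" where "\<kappa> = (\<lambda>j. if j = 0 then 1 else 0)"
  have "(\<lambda>j. \<bar>\<kappa> j\<bar>) sums 1"
    using sums_single[of 0 "\<lambda>_. 1 :: real"] by (simp add: \<kappa>_def if_distrib cong: if_cong)
  moreover have "(\<lambda>j. \<kappa> j * s ^ j) sums 1" for s
    using sums_single[of 0 "\<lambda>_. 1 :: real"] by (rule sums_cong[THEN iffD1, rotated]) (auto simp: \<kappa>_def)
  ultimately show ?thesis
    unfolding has_l1_series_def by (auto simp: sums_iff intro!: exI[of _ \<kappa>])
qed

lemma has_l1_series_mult:
  assumes "has_l1_series C f" "has_l1_series C' g"
  shows "has_l1_series (C * C') (\<lambda>s. f s * g s)"
proof -
  obtain \<kappa> where \<kappa>: "summable (\<lambda>j. \<bar>\<kappa> j\<bar>)" "(\<Sum>j. \<bar>\<kappa> j\<bar>) \<le> C" "\<And>s. s \<in> {0..1} \<Longrightarrow> (\<lambda>j. \<kappa> j * s ^ j) sums f s"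
    using assms(1) unfolding has_l1_series_def by auto
  obtain \<mu> where \<mu>: "summable (\<lambda>j. \<bar>\<mu> j\<bar>)" "(\<Sum>j. \<bar>\<mu> j\<bar>) \<le> C'" "\<And>s. s \<in> {0..1} \<Longrightarrow> (\<lambda>j. \<mu> j * s ^ j) sums g s"
    using assms(2) unfolding has_l1_series_def by auto
  define \<rho> where "\<rho> = (\<lambda>j. \<Sum>i\<le>j. \<kappa> i * \<mu> (j - i))"
  have abs_sums: "(\<lambda>j. \<Sum>i\<le>j. \<bar>\<kappa> i\<bar> * \<bar>\<mu> (j - i)\<bar>) sums ((\<Sum>j. \<bar>\<kappa> j\<bar>) * (\<Sum>j. \<bar>\<mu> j\<bar>))"
    using \<kappa>(1) \<mu>(1) by (intro Cauchy_product_sums) auto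
  have le: "\<bar>\<rho> j\<bar> \<le> (\<Sum>i\<le>j. \<bar>\<kappa> i\<bar> * \<bar>\<mu> (j - i)\<bar>)" for j
    unfolding \<rho>_def by (rule order_trans[OF sum_abs]) (simp add: abs_mult)
  have sm: "summable (\<lambda>j. \<bar>\<rho> j\<bar>)"
    using le by (intro summable_comparison_test'[OF sums_summable[OF abs_sums], of 0]) auto
  have "(\<Sum>j. \<bar>\<rho> j\<bar>) \<le> (\<Sum>j. \<bar>\<kappa> j\<bar>) * (\<Sum>j. \<bar>\<mu> j\<bar>)"
    using suminf_le[OF le sm sums_summable[OF abs_sums]] sums_unique[OF abs_sums] by simp
  also have "\<dots> \<le> C * C'"
    using \<kappa>(1,2) \<mu>(1,2) by (intro mult_mono suminf_nonneg order_trans[OF suminf_nonneg \<kappa>(2)]) auto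
  finally have bound: "(\<Sum>j. \<bar>\<rho> j\<bar>) \<le> C * C'" .
  have "(\<lambda>j. \<rho> j * s ^ j) sums (f s * g s)" if s: "s \<in> {0..1}" for s
  proof -
    have smk: "summable (\<lambda>j. norm (\<nu> j * s ^ j))" if "summable (\<lambda>j. \<bar>\<nu> j\<bar>)" for \<nu> :: "nat \<Rightarrow> real"
      using s by (intro summable_comparison_test'[OF that, of 0])
        (auto simp: abs_mult power_abs intro!: mult_left_le power_le_one)
    have "(\<lambda>j. \<Sum>i\<le>j. (\<kappa> i * s ^ i) * (\<mu> (j - i) * s ^ (j - i))) sums ((\<Sum>j. \<kappa> j * s ^ j) * (\<Sum>j. \<mu> j * s ^ j))"
      using smk[OF \<kappa>(1)] smk[OF \<mu>(1)] by (rule Cauchy_product_sums)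
    moreover have "(\<Sum>i\<le>j. (\<kappa> i * s ^ i) * (\<mu> (j - i) * s ^ (j - i))) = \<rho> j * s ^ j" for j
      unfolding \<rho>_def sum_distrib_right
    proof (intro sum.cong refl)
      fix i assume "i \<in> {..j}"
      then have "s ^ j = s ^ i * s ^ (j - i)" by (simp flip: power_add)
      then show "(\<kappa> i * s ^ i) * (\<mu> (j - i) * s ^ (j - i)) = \<kappa> i * \<mu> (j - i) * s ^ j" by simp
    qed
    ultimately show ?thesis
      using \<kappa>(3)[OF s] \<mu>(3)[OF s] by (simp add: sums_iff)
  qed
  then show ?thesis unfolding has_l1_series_def using sm bound by blast
qed

lemma has_l1_series_prod:
  assumes "\<And>i. i < r \<Longrightarrow> has_l1_series C (f i)"
  shows "has_l1_series (C ^ r) (\<lambda>s. \<Prod>i<r. f i s)"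
  using assms
proof (induction r)
  case 0
  then show ?case by (simp add: has_l1_series_one)
next
  case (Suc r)
  then have "has_l1_series (C ^ r * C) (\<lambda>s. (\<Prod>i<r. f i s) * f r s)"
    by (intro has_l1_series_mult) auto
  then show ?case by (simp add: mult.commute)
qed

text \<open>The step from \<open>j\<close> to \<open>Suc j\<close> multiplies by
  \<open>(\<alpha> - j) / (j + 1)\<close>, which is at most 1 in absolute value.\<close>

lemma abs_gbinomial_le_one:
  fixes \<alpha> :: real
  assumes "0 \<le> \<alpha>" "\<alpha> \<le> 1"
  shows "\<bar>\<alpha> gchoose j\<bar> \<le> 1"
proof (induction j)
  case (Suc j)
  have "\<alpha> gchoose Suc j = (\<alpha> gchoose j) * ((\<alpha> - real j) / real (Suc j))"
    using gbinomial_absorption'[of "Suc j" \<alpha>] gbinomial_mult_1[of \<alpha> j]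
    by (simp add: field_simps)
  moreover have "\<bar>(\<alpha> - real j) / real (Suc j)\<bar> \<le> 1"
    using assms by (auto simp: abs_if field_simps)
  ultimately show ?case
    using Suc by (simp only: abs_mult) (intro mult_le_one, auto)
qed simp

text \<open>The coefficients are at most \<open>z ^ j \<le> (1/2) ^ j\<close> whatever the exponent
  \<alpha>; thanks to this uniformity all monomials share one bound.\<close>

lemma has_l1_series_powr:
  fixes \<alpha> z :: real
  assumes "0 \<le> \<alpha>" "\<alpha> \<le> 1" "0 \<le> z" "z \<le> 1/2"
  shows "has_l1_series 2 (\<lambda>s. (1 + z * s) powr \<alpha>)"
proof -
  define \<kappa> where "\<kappa> = (\<lambda>j. (\<alpha> gchoose j) * z ^ j)"
  have geo: "(\<lambda>j. (1/2) ^ j :: real) sums 2" using geometric_sums[of "1/2 :: real"] by simp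
  have le: "\<bar>\<kappa> j\<bar> \<le> (1/2) ^ j" for j
  proof -
    have "\<bar>\<kappa> j\<bar> \<le> 1 * z ^ j"
      unfolding \<kappa>_def abs_mult using assms abs_gbinomial_le_one[of \<alpha> j] by (intro mult_mono) auto
    also have "\<dots> \<le> (1/2) ^ j" using power_mono[OF assms(4,3), of j] by simp
    finally show ?thesis .
  qed
  have sm: "summable (\<lambda>j. \<bar>\<kappa> j\<bar>)"
    using le by (intro summable_comparison_test'[OF sums_summable[OF geo], of 0]) auto
  have "(\<Sum>j. \<bar>\<kappa> j\<bar>) \<le> 2"
    using suminf_le[OF le sm sums_summable[OF geo]] sums_unique[OF geo] by simp
  moreover have "(\<lambda>j. \<kappa> j * s ^ j) sums ((1 + z * s) powr \<alpha>)" if "s \<in> {0..1}" for s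
  proof -
    have "z * s \<le> 1/2 * 1" using that assms by (intro mult_mono) auto
    then have "\<bar>z * s\<bar> < 1" using that assms by auto
    from gen_binomial_real[OF this, of \<alpha>] show ?thesis
      by (simp add: \<kappa>_def power_mult_distrib mult.assoc)
  qed
  ultimately show ?thesis unfolding has_l1_series_def using sm by blast
qed

text \<open>On [0, 1/2] every power of \<open>s\<close> in the tail is at most
  \<open>1 / 2 ^ T\<close>, and the coefficients in the tail sum to at most
  \<open>C\<close>.\<close>

lemma has_l1_series_truncate:
  assumes "has_l1_series C f"
  shows "\<exists>\<kappa>. (\<forall>j. \<bar>\<kappa> j\<bar> \<le> C) \<and> (\<forall>T. \<forall>s\<in>{0..1/2}. \<bar>f s - (\<Sum>j<T. \<kappa> j * s ^ j)\<bar> \<le> C / 2 ^ T)"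
proof -
  obtain \<kappa> where \<kappa>: "summable (\<lambda>j. \<bar>\<kappa> j\<bar>)" "(\<Sum>j. \<bar>\<kappa> j\<bar>) \<le> C" "\<And>s. s \<in> {0..1} \<Longrightarrow> (\<lambda>j. \<kappa> j * s ^ j) sums f s"
    using assms unfolding has_l1_series_def by auto
  have partial: "(\<Sum>j\<in>J. \<bar>\<kappa> j\<bar>) \<le> C" if "finite J" for J
    using sum_le_suminf[OF \<kappa>(1) that] \<kappa>(2) by simp
  have "\<bar>\<kappa> j\<bar> \<le> C" for j using partial[of "{j}"] by simp
  moreover have "\<bar>f s - (\<Sum>j<T. \<kappa> j * s ^ j)\<bar> \<le> C / 2 ^ T" if s: "s \<in> {0..1/2}" for T s
  proof -
    have "(\<lambda>n. \<Sum>j<n. \<kappa> j * s ^ j) \<longlonglongrightarrow> f s" using \<kappa>(3)[of s] s by (simp add: sums_def)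
    then have lim: "(\<lambda>n. \<bar>(\<Sum>j<n. \<kappa> j * s ^ j) - (\<Sum>j<T. \<kappa> j * s ^ j)\<bar>) \<longlonglongrightarrow> \<bar>f s - (\<Sum>j<T. \<kappa> j * s ^ j)\<bar>"
      by (intro tendsto_intros)
    have "\<bar>(\<Sum>j<n. \<kappa> j * s ^ j) - (\<Sum>j<T. \<kappa> j * s ^ j)\<bar> \<le> C / 2 ^ T" if "n \<ge> T" for n
    proof -
      have "(\<Sum>j<n. \<kappa> j * s ^ j) - (\<Sum>j<T. \<kappa> j * s ^ j) = (\<Sum>j\<in>{T..<n}. \<kappa> j * s ^ j)"
        using that sum_diff_nat_ivl[of 0 T n "\<lambda>j. \<kappa> j * s ^ j"] by (simp add: atLeast0LessThan)
      also have "\<bar>\<dots>\<bar> \<le> (\<Sum>j\<in>{T..<n}. \<bar>\<kappa> j\<bar> * (1 / 2 ^ T))"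
      proof (rule order_trans[OF sum_abs], rule sum_mono)
        fix j assume "j \<in> {T..<n}"
        have "s ^ j \<le> (1/2) ^ j" using s by (intro power_mono) auto
        also have "\<dots> \<le> (1/2) ^ T" using \<open>j \<in> {T..<n}\<close> by (intro power_decreasing) auto
        finally have "s ^ j \<le> 1 / 2 ^ T" by (simp add: power_one_over)
        then show "\<bar>\<kappa> j * s ^ j\<bar> \<le> \<bar>\<kappa> j\<bar> * (1 / 2 ^ T)"
          using s mult_left_mono[of "s ^ j" "1 / 2 ^ T" "\<bar>\<kappa> j\<bar>"] by (simp add: abs_mult)
      qed
      also have "\<dots> = (\<Sum>j\<in>{T..<n}. \<bar>\<kappa> j\<bar>) * (1 / 2 ^ T)" by (simp only: sum_distrib_right)
      also have "\<dots> \<le> C * (1 / 2 ^ T)" using partial[of "{T..<n}"] by (intro mult_right_mono) auto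
      finally show ?thesis by simp
    qed
    then show ?thesis
      using lim by (intro LIMSEQ_le_const2[OF lim]) blast
  qed
  ultimately show ?thesis by blast
qed

section \<open>Pigeonhole principle and vanishing on a set of slow variation\<close>

text \<open>Siegel's argument: \<open>(H + 1) ^ card E\<close> coefficient vectors face
  \<open>T\<close> conditions. As \<open>card E \<ge> 2 * T\<close>, it suffices that each condition
  has at most \<open>H * H\<close> boxes; the difference of two vectors in the same boxes is the
  required \<open>c\<close>.\<close>

lemma small_combination:
  fixes w :: "'a \<Rightarrow> nat \<Rightarrow> real" and W T :: nat
  assumes E: "finite E" "2 * T \<le> card E" "T \<ge> 1" and W: "W \<ge> 1" "\<And>e j. e \<in> E \<Longrightarrow> j < T \<Longrightarrow> \<bar>w e j\<bar> \<le> real W"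
  shows "\<exists>c :: 'a \<Rightarrow> int. (\<exists>e\<in>E. c e \<noteq> 0) \<and> (\<forall>e\<in>E. \<bar>c e\<bar> \<le> int (7 * T * card E * W)) \<and>
    (\<forall>j<T. \<bar>\<Sum>e\<in>E. real_of_int (c e) * w e j\<bar> \<le> 1 / (2 * real T))"
proof -
  define D where "D = card E"
  \<comment> \<open>The factor 7 makes \<open>H * H = 7 * T * D * H * W\<close>, which is at least
    the number \<open>2 * K + 1 = 4 * T * D * H * W + 3\<close> of boxes per condition.\<close>
  define H where "H = 7 * T * D * W"
  define X where "X = (E \<rightarrow>\<^sub>E {0..H})"
  \<comment> \<open>After scaling by \<open>2 * T\<close>, sharing a box of unit length means
    differing by at most \<open>1 / (2 * T)\<close> before scaling, so that the \<open>T\<close>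
    conditions can together contribute at most 1/2.\<close>
  define val where "val = (\<lambda>c :: 'a \<Rightarrow> nat. \<lambda>j. (\<Sum>e\<in>E. real (c e) * w e j) * (2 * real T))"
  define box where "box = (\<lambda>c. restrict (\<lambda>j. \<lfloor>val c j\<rfloor>) {..<T})"
  define K where "K = 2 * T * D * H * W + 1"
  have pos: "D \<ge> 1" "H \<ge> 1" using assms by (auto simp: D_def H_def)
  have cX: "card X = (H + 1) ^ D" using E(1) by (simp add: X_def D_def card_PiE)
  have "\<bar>val c j\<bar> \<le> real (2 * T * D * H * W)" if c: "c \<in> X" and j: "j < T" for c j
  proof -
    have "\<bar>\<Sum>e\<in>E. real (c e) * w e j\<bar> \<le> (\<Sum>e\<in>E. real H * real W)"
    proof (rule order_trans[OF sum_abs], rule sum_mono)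
      fix e assume e: "e \<in> E"
      then have "c e \<le> H" using c by (auto simp: X_def PiE_def Pi_def)
      then show "\<bar>real (c e) * w e j\<bar> \<le> real H * real W"
        unfolding abs_mult using W(2)[OF e j] by (intro mult_mono) auto
    qed
    also have "\<dots> = real D * real H * real W" by (simp add: D_def)
    finally have "\<bar>val c j\<bar> \<le> (real D * real H * real W) * (2 * real T)"
      unfolding val_def abs_mult by (intro mult_mono) auto
    then show ?thesis by (simp add: mult_ac)
  qed
  then have fl: "\<lfloor>val c j\<rfloor> \<in> {- int K..int K}" if "c \<in> X" "j < T" for c j
    using that by (fastforce simp: K_def abs_le_iff le_floor_iff floor_le_iff)
  have "card (box ` X) \<le> card ({..<T} \<rightarrow>\<^sub>E {- int K..int K})"
    using fl unfolding box_def by (intro card_mono finite_PiE image_subsetI) (auto simp only: restrict_PiE_iff finite_atLeastAtMost_int finite_lessThan lessThan_iff)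
  also have "\<dots> = (2 * K + 1) ^ T" by (simp add: card_PiE nat_add_distrib nat_mult_distrib)
  also have "\<dots> \<le> (H * H) ^ T"
  proof (rule power_mono)
    have "1 \<le> T * D * H * W" using pos assms by simp
    then have "2 * K + 1 \<le> 7 * (T * D * H * W)" by (simp add: K_def)
    also have "\<dots> = H * H" by (simp add: H_def mult_ac)
    finally show "2 * K + 1 \<le> H * H" .
  qed simp
  also have "\<dots> = H ^ (2 * T)" by (simp add: power_mult power2_eq_square)
  also have "\<dots> < (H + 1) ^ (2 * T)" using E(3) by (intro power_strict_mono) auto
  also have "\<dots> \<le> (H + 1) ^ D" using E(2) by (intro power_increasing) (auto simp: D_def)
  finally have "card (box ` X) < card X" by (simp add: cX)
  then have "\<not> inj_on box X" by (rule pigeonhole)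
  then obtain c c' where c: "c \<in> X" "c' \<in> X" "c \<noteq> c'" "box c = box c'"
    unfolding inj_on_def by blast
  define d where "d = (\<lambda>e. int (c e) - int (c' e))"
  have "\<exists>e\<in>E. d e \<noteq> 0"
  proof (rule ccontr)
    assume "\<not> ?thesis"
    then have "c = c'" using c(1,2) unfolding X_def by (intro PiE_ext[of c E "\<lambda>_. {0..H}" c']) (auto simp: d_def)
    then show False using c(3) by simp
  qed
  moreover have "\<bar>d e\<bar> \<le> int H" if "e \<in> E" for e
  proof -
    have "c e \<le> H" "c' e \<le> H" using c(1,2) that by (auto simp: X_def PiE_def Pi_def)
    then show ?thesis by (simp add: d_def)
  qed
  moreover have "\<bar>\<Sum>e\<in>E. real_of_int (d e) * w e j\<bar> \<le> 1 / (2 * real T)" if j: "j < T" for j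
  proof -
    have "\<lfloor>val c j\<rfloor> = \<lfloor>val c' j\<rfloor>" using c(4) j by (metis box_def lessThan_iff restrict_apply)
    then have "\<bar>val c j - val c' j\<bar> \<le> 1" by linarith
    moreover have "val c j - val c' j = (\<Sum>e\<in>E. real_of_int (d e) * w e j) * (2 * real T)"
      by (simp add: val_def d_def left_diff_distrib sum_subtractf)
    ultimately have "\<bar>\<Sum>e\<in>E. real_of_int (d e) * w e j\<bar> * (2 * real T) \<le> 1"
      by (simp add: abs_mult)
    then show ?thesis using E(3) by (simp add: field_simps)
  qed
  ultimately show ?thesis unfolding H_def D_def by blast
qed

text \<open>\<open>W\<close> bounds the Taylor coefficients of every monomial: \<open>M ^ r\<close>
  comes from its value at the least element of \<open>S\<close>, and \<open>2 ^ r\<close> from the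
  \<open>r\<close> power series. The last condition on \<open>T\<close> makes the Taylor remainder
  of the whole combination less than 1/2.\<close>

lemma card_fibre_le:
  fixes k r T M W :: nat and n :: int and a :: "nat \<Rightarrow> nat" and S :: "nat set" and x :: "nat \<Rightarrow> nat \<Rightarrow> int"
  assumes k: "k \<ge> 1" and n: "n \<noteq> 0" and inj: "inj_on a {..<r}" and a: "\<And>i. i < r \<Longrightarrow> a i \<ge> 1"
    and S: "finite S" "S \<noteq> {}"
    and x: "\<And>b i. b \<in> S \<Longrightarrow> i < r \<Longrightarrow> x b i \<ge> 1"
    and root: "\<And>b i. b \<in> S \<Longrightarrow> i < r \<Longrightarrow> x b i ^ k = int (a i) * int b + n"
    and ratio: "\<And>b b' i. b \<in> S \<Longrightarrow> b' \<in> S \<Longrightarrow> i < r \<Longrightarrow> 4 * (int (a i) * int b' + n) \<le> 5 * (int (a i) * int b + n)"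
    and size: "\<And>b i. b \<in> S \<Longrightarrow> i < r \<Longrightarrow> int (a i) * int b + n \<le> int M"
    and W: "W = M ^ r * 2 ^ r" and M: "M \<ge> 1"
    and T: "T \<ge> 1" "2 * T \<le> k ^ r" "14 * T * (k ^ r) ^ 2 * W ^ 2 < 2 ^ T"
  shows "card S \<le> r * k ^ r"
proof -
  define E where "E = exps k r"
  define D where "D = k ^ r"
  have E: "finite E" "card E = D" by (simp_all add: E_def D_def card_exps)
  define F where "F = (\<lambda>b e. mono_at r (\<lambda>i. real_of_int (x b i)) e)"
  define u where "u = Min S"
  define v where "v = Max S"
  have uv: "u \<in> S" "v \<in> S" "\<And>b. b \<in> S \<Longrightarrow> u \<le> b \<and> b \<le> v"
    using S by (auto simp: u_def v_def)
  define \<alpha> where "\<alpha> = (\<lambda>i. real (a i) * real u + real_of_int n)"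
  have rootr: "real_of_int (x b i) ^ k = real (a i) * real b + real_of_int n" if "b \<in> S" "i < r" for b i
    using arg_cong[OF root[OF that], of real_of_int] by simp
  have xpos: "real_of_int (x b i) \<ge> 1" if "b \<in> S" "i < r" for b i
    using x[OF that] by simp
  have \<alpha>pos: "\<alpha> i \<ge> 1" if "i < r" for i
    using rootr[OF uv(1) that] one_le_power[OF xpos[OF uv(1) that], of k] by (simp add: \<alpha>_def)
  \<comment> \<open>With \<open>b = u + 2 * (v - u) * s\<close> and \<open>s = \<sigma> b\<close>,
    the value \<open>a i * b + n\<close> becomes \<open>\<alpha> i * (1 + z i * s)\<close>. The
    factor 2 confines \<open>s\<close> to [0, 1/2], while \<open>ratio\<close> still gives
    \<open>z i \<le> 1/2\<close>.\<close>
  define z where "z = (\<lambda>i. 2 * (real v - real u) * real (a i) / \<alpha> i)"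
  have z: "0 \<le> z i" "z i \<le> 1/2" if i: "i < r" for i
  proof -
    show "0 \<le> z i" using \<alpha>pos[OF i] uv(3)[OF uv(1)] by (simp add: z_def)
    have "real_of_int (4 * (int (a i) * int v + n)) \<le> real_of_int (5 * (int (a i) * int u + n))"
      using ratio[OF uv(1,2) i] by (simp only: of_int_le_iff)
    then have "4 * ((real v - real u) * real (a i)) \<le> \<alpha> i" by (simp add: \<alpha>_def algebra_simps)
    then show "z i \<le> 1/2" using \<alpha>pos[OF i] by (simp add: z_def field_simps)
  qed
  \<comment> \<open>If \<open>u = v\<close>, division by zero gives \<open>\<sigma> b = 0\<close>,
    which is the correct point.\<close>
  define \<sigma> where "\<sigma> = (\<lambda>b. (real b - real u) / (2 * (real v - real u)))"
  have \<sigma>: "\<sigma> b \<in> {0..1/2}" if "b \<in> S" for b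
    using uv(3)[OF that] by (cases "u = v") (auto simp: \<sigma>_def divide_le_eq)
  have z\<sigma>: "1 + z i * \<sigma> b = (real_of_int (x b i) / real_of_int (x u i)) ^ k" if b: "b \<in> S" and i: "i < r" for b i
  proof -
    have "z i * \<sigma> b = (real b - real u) * real (a i) / \<alpha> i"
      using uv(3)[OF b] by (cases "u = v") (auto simp: z_def \<sigma>_def)
    then have "1 + z i * \<sigma> b = (real (a i) * real b + real_of_int n) / \<alpha> i"
      using \<alpha>pos[OF i] by (simp add: \<alpha>_def field_simps)
    then show ?thesis using rootr[OF b i] rootr[OF uv(1) i] by (simp add: power_divide \<alpha>_def)
  qed
  define f where "f = (\<lambda>e s. \<Prod>i<r. (1 + z i * s) powr (real (e i) / real k))"
  have Ff: "F b e = F u e * f e (\<sigma> b)" if b: "b \<in> S" and e: "e \<in> E" for b e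
  proof -
    have "(1 + z i * \<sigma> b) powr (real (e i) / real k) = real_of_int (x b i) ^ e i / real_of_int (x u i) ^ e i"
      if i: "i < r" for i
    proof -
      define q where "q = real_of_int (x b i) / real_of_int (x u i)"
      have q: "q > 0" using xpos[OF b i] xpos[OF uv(1) i] by (simp add: q_def)
      have "(q ^ k) powr (real (e i) / real k) = q powr (real k * (real (e i) / real k))"
        using q by (simp add: powr_powr flip: powr_realpow)
      also have "\<dots> = q ^ e i" using q k by (simp add: powr_realpow)
      finally show ?thesis unfolding z\<sigma>[OF b i] q_def[symmetric] by (simp add: q_def power_divide)
    qed
    then have "F u e * f e (\<sigma> b) = (\<Prod>i<r. real_of_int (x u i) ^ e i * (real_of_int (x b i) ^ e i / real_of_int (x u i) ^ e i))"
      unfolding F_def f_def mono_at_def prod.distrib[symmetric] by (intro prod.cong refl) auto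
    also have "\<dots> = F b e"
      unfolding F_def mono_at_def
    proof (intro prod.cong refl)
      fix i assume "i \<in> {..<r}"
      then show "real_of_int (x u i) ^ e i * (real_of_int (x b i) ^ e i / real_of_int (x u i) ^ e i) = real_of_int (x b i) ^ e i"
        using xpos[OF uv(1), of i] by simp
    qed
    finally show ?thesis by simp
  qed
  have Fu: "0 \<le> F u e" "F u e \<le> real M ^ r" if e: "e \<in> E" for e
  proof -
    have "real_of_int (x u i) ^ e i \<le> real M" if i: "i < r" for i
    proof -
      have "real_of_int (x u i) ^ e i \<le> real_of_int (x u i) ^ k"
        using xpos[OF uv(1) i] exps_less[OF e[unfolded E_def] i] by (intro power_increasing) auto
      also have "\<dots> = real_of_int (int (a i) * int u + n)" using rootr[OF uv(1) i] by simp
      also have "\<dots> \<le> real_of_int (int M)" using size[OF uv(1) i] by (simp only: of_int_le_iff)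
      finally show ?thesis by simp
    qed
    moreover have x0: "0 \<le> real_of_int (x u i) ^ e i" if "i < r" for i using xpos[OF uv(1) that] by simp
    ultimately have "F u e \<le> (\<Prod>i<r. real M)"
      unfolding F_def mono_at_def by (intro prod_mono) auto
    then show "F u e \<le> real M ^ r" by simp
    show "0 \<le> F u e" unfolding F_def mono_at_def using x0 by (intro prod_nonneg) auto
  qed
  have "has_l1_series (2 ^ r) (f e)" if "e \<in> E" for e
    unfolding f_def
  proof (rule has_l1_series_prod, rule has_l1_series_powr)
    fix i assume i: "i < r"
    have "e i < k" using exps_less i that by (simp add: E_def)
    then show "real (e i) / real k \<le> 1" by simp
  qed (use z in auto)
  then have "\<forall>e. \<exists>\<kappa>. e \<in> E \<longrightarrow> (\<forall>j. \<bar>\<kappa> j\<bar> \<le> 2 ^ r) \<and>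
      (\<forall>T. \<forall>s\<in>{0..1/2}. \<bar>f e s - (\<Sum>j<T. \<kappa> j * s ^ j)\<bar> \<le> 2 ^ r / 2 ^ T)"
    using has_l1_series_truncate by metis
  then obtain \<kappa> where "\<forall>e. e \<in> E \<longrightarrow> (\<forall>j. \<bar>\<kappa> e j\<bar> \<le> 2 ^ r) \<and>
      (\<forall>T. \<forall>s\<in>{0..1/2}. \<bar>f e s - (\<Sum>j<T. \<kappa> e j * s ^ j)\<bar> \<le> 2 ^ r / 2 ^ T)"
    by (rule choice[THEN exE])
  then have \<kappa>: "\<And>e j. e \<in> E \<Longrightarrow> \<bar>\<kappa> e j\<bar> \<le> 2 ^ r"
    "\<And>e T s. e \<in> E \<Longrightarrow> s \<in> {0..1/2} \<Longrightarrow> \<bar>f e s - (\<Sum>j<T. \<kappa> e j * s ^ j)\<bar> \<le> 2 ^ r / 2 ^ T"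
    by blast+
  define w where "w = (\<lambda>e j. F u e * \<kappa> e j)"
  have "\<bar>w e j\<bar> \<le> real W" if "e \<in> E" for e j
  proof -
    have "\<bar>w e j\<bar> \<le> real M ^ r * 2 ^ r"
      unfolding w_def abs_mult using Fu[OF that] \<kappa>(1)[OF that, of j] by (intro mult_mono) auto
    then show ?thesis by (simp add: W)
  qed
  moreover have "W \<ge> 1" using M by (simp add: W)
  moreover have "2 * T \<le> card E" using T(2) by (simp add: E D_def)
  ultimately obtain c where c: "\<exists>e\<in>E. c e \<noteq> 0" "\<And>e. e \<in> E \<Longrightarrow> \<bar>c e\<bar> \<le> int (7 * T * D * W)"
    "\<And>j. j < T \<Longrightarrow> \<bar>\<Sum>e\<in>E. real_of_int (c e) * w e j\<bar> \<le> 1 / (2 * real T)"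
    using small_combination[of E T W w] E T(1) by auto
  have zero: "(\<Sum>e\<in>E. real_of_int (c e) * F b e) = 0" if b: "b \<in> S" for b
  proof -
    define s where "s = \<sigma> b"
    have s: "s \<in> {0..1/2}" "0 \<le> s" "s \<le> 1" using \<sigma>[OF b] by (auto simp: s_def)
    \<comment> \<open>The contribution of the first \<open>T\<close> Taylor coefficients:
      \<open>T\<close> terms of size at most \<open>1 / (2 * T)\<close>.\<close>
    define P where "P = (\<Sum>j<T. (\<Sum>e\<in>E. real_of_int (c e) * w e j) * s ^ j)"
    have "\<bar>P\<bar> \<le> (\<Sum>j<T. 1 / (2 * real T))"
      unfolding P_def
    proof (rule order_trans[OF sum_abs], rule sum_mono)
      fix j assume "j \<in> {..<T}"
      then have "\<bar>\<Sum>e\<in>E. real_of_int (c e) * w e j\<bar> * \<bar>s ^ j\<bar> \<le> 1 / (2 * real T) * 1"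
        using c(3)[of j] s by (intro mult_mono) (auto simp: power_le_one)
      then show "\<bar>(\<Sum>e\<in>E. real_of_int (c e) * w e j) * s ^ j\<bar> \<le> 1 / (2 * real T)"
        by (simp add: abs_mult)
    qed
    also have "\<dots> = 1/2" using T(1) by simp
    finally have P: "\<bar>P\<bar> \<le> 1/2" .
    have "P = (\<Sum>e\<in>E. real_of_int (c e) * (F u e * (\<Sum>j<T. \<kappa> e j * s ^ j)))"
      unfolding P_def w_def sum_distrib_right sum_distrib_left by (subst sum.swap) (simp add: mult_ac)
    then have "(\<Sum>e\<in>E. real_of_int (c e) * F b e) - P
        = (\<Sum>e\<in>E. real_of_int (c e) * (F u e * (f e s - (\<Sum>j<T. \<kappa> e j * s ^ j))))"
      using Ff[OF b] by (simp add: s_def sum_subtractf[symmetric] algebra_simps)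
    \<comment> \<open>Each of the \<open>D\<close> monomials contributes at most the coefficient
      bound \<open>7 * T * D * W\<close> times the tail bound \<open>W / 2 ^ T\<close>; the 14 in
      the hypothesis is twice this 7.\<close>
    also have "\<bar>\<dots>\<bar> \<le> (\<Sum>e\<in>E. real (7 * T * D * W) * (real M ^ r * (2 ^ r / 2 ^ T)))"
    proof (rule order_trans[OF sum_abs], rule sum_mono)
      fix e assume e: "e \<in> E"
      have "real_of_int \<bar>c e\<bar> \<le> real_of_int (int (7 * T * D * W))" using c(2)[OF e] by (simp only: of_int_le_iff)
      then have "\<bar>real_of_int (c e)\<bar> \<le> real (7 * T * D * W)" by simp
      then show "\<bar>real_of_int (c e) * (F u e * (f e s - (\<Sum>j<T. \<kappa> e j * s ^ j)))\<bar>
          \<le> real (7 * T * D * W) * (real M ^ r * (2 ^ r / 2 ^ T))"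
        unfolding abs_mult using Fu[OF e] \<kappa>(2)[OF e s(1), of T] by (intro mult_mono) auto
    qed
    also have "\<dots> = real (7 * T * D ^ 2 * W ^ 2) / 2 ^ T"
      by (simp add: E W power2_eq_square mult_ac)
    also have "\<dots> < 1/2"
    proof -
      have "real (14 * T * D ^ 2 * W ^ 2) < real (2 ^ T)" using T(3) by (simp only: D_def of_nat_less_iff)
      then show ?thesis by (simp add: field_simps)
    qed
    finally have "\<bar>\<Sum>e\<in>E. real_of_int (c e) * F b e\<bar> < 1" using P by linarith
    moreover have sum_int: "(\<Sum>e\<in>E. real_of_int (c e) * F b e) = real_of_int (\<Sum>e\<in>E. c e * mono_at r (x b) e)"
      by (simp add: F_def mono_at_def)
    ultimately have "\<bar>\<Sum>e\<in>E. c e * mono_at r (x b) e\<bar> < 1" by linarith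
    then show ?thesis unfolding sum_int by simp
  qed
  \<comment> \<open>Shifting the variable by \<open>u\<close> makes the constant terms equal to the
    positive \<open>\<alpha> i\<close>, as the zero count demands. The index
    \<open>nat \<lfloor>t\<rfloor> + u\<close> recovers \<open>b\<close>.\<close>
  define \<tau> where "\<tau> = (\<lambda>b. real b - real u)"
  have \<tau>_inv: "nat \<lfloor>\<tau> b\<rfloor> + u = b" if "b \<in> S" for b
  proof -
    have "\<tau> b = real (b - u)" using uv(3)[OF that] by (simp add: \<tau>_def of_nat_diff)
    then show ?thesis using uv(3)[OF that] by (simp del: of_nat_diff)
  qed
  obtain e1 where e1: "e1 \<in> exps k r" "real_of_int (c e1) \<noteq> 0" using c(1) by (auto simp: E_def)
  \<comment> \<open>The two sides differ by \<open>n * (a j - a i)\<close>; here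
    \<open>n \<noteq> 0\<close> and the distinctness of the \<open>a i\<close> enter.\<close>
  have pair: "\<alpha> i * real (a j) \<noteq> \<alpha> j * real (a i)" if "i < r" "j < r" "i \<noteq> j" for i j
  proof
    assume "\<alpha> i * real (a j) = \<alpha> j * real (a i)"
    then have "real_of_int n * (real (a j) - real (a i)) = 0" by (simp add: \<alpha>_def algebra_simps)
    then show False using n inj_onD[OF inj, of i j] that by auto
  qed
  have "finite (\<tau> ` S) \<and> card (\<tau> ` S) \<le> r * k ^ r"
  proof (rule card_zeros_mono_at_combination[where x = "\<lambda>t i. real_of_int (x (nat \<lfloor>t\<rfloor> + u) i)"
        and c = "\<lambda>e. real_of_int (c e)" and a = "\<lambda>i. real (a i)", OF k _ _ pair e1])
    show "0 < \<alpha> i" "real (a i) \<noteq> 0" if "i < r" for i using \<alpha>pos[OF that] a[OF that] by auto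
    fix t assume "t \<in> \<tau> ` S"
    then obtain b where b: "b \<in> S" "t = \<tau> b" by auto
    show "real_of_int (x (nat \<lfloor>t\<rfloor> + u) i) ^ k = \<alpha> i + real (a i) * t" if "i < r" for i
      using rootr[OF b(1) that] unfolding b(2) \<tau>_inv[OF b(1)] by (simp add: \<alpha>_def \<tau>_def algebra_simps)
    show "(\<Sum>e\<in>exps k r. real_of_int (c e) * mono_at r (\<lambda>i. real_of_int (x (nat \<lfloor>t\<rfloor> + u) i)) e) = 0"
      using zero[OF b(1)] unfolding b(2) \<tau>_inv[OF b(1)] by (simp add: F_def E_def)
  qed
  moreover have "card (\<tau> ` S) = card S" by (intro card_image) (auto simp: \<tau>_def inj_on_def)
  ultimately show ?thesis by simp
qed

section \<open>Splitting B by logarithmic scales\<close>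

text \<open>The base 5/4 is the variation that \<open>card_fibre_le\<close> tolerates, so integers
  of equal scale satisfy its ratio condition.\<close>

definition log_scale :: "int \<Rightarrow> nat" where
  "log_scale y = nat \<lfloor>log (5/4) (real_of_int y)\<rfloor>"

lemma log_scale_mono: "1 \<le> y \<Longrightarrow> y \<le> y' \<Longrightarrow> log_scale y \<le> log_scale y'"
  unfolding log_scale_def by (intro nat_mono floor_mono) simp

lemma log_scale_eq_imp_close:
  assumes "1 \<le> y" "1 \<le> y'" "log_scale y = log_scale y'"
  shows "4 * y' \<le> 5 * y"
proof -
  have "0 \<le> \<lfloor>log (5/4) (real_of_int y)\<rfloor>" "0 \<le> \<lfloor>log (5/4) (real_of_int y')\<rfloor>"
    using assms(1,2) by auto
  then have "\<lfloor>log (5/4) (real_of_int y)\<rfloor> = \<lfloor>log (5/4) (real_of_int y')\<rfloor>"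
    using assms(3) unfolding log_scale_def by linarith
  then have "log (5/4) (real_of_int y') < log (5/4) (real_of_int y) + 1" by linarith
  also have "\<dots> = log (5/4) (real_of_int y * (5/4))"
    using assms(1) by (subst log_mult) auto
  finally have "real_of_int y' < real_of_int y * (5/4)"
    using assms(1,2) by simp
  then have "real_of_int (4 * y') < real_of_int (5 * y)" by simp
  then show ?thesis by (simp only: of_int_less_iff)
qed

text \<open>Four steps of ratio 5/4 exceed a doubling, since
  \<open>(5/4) ^ 4 = 625/256\<close>.\<close>

lemma log_scale_le:
  assumes "1 \<le> y" "y \<le> 2 ^ m"
  shows "log_scale y \<le> 4 * m"
proof -
  have "real_of_int y \<le> real_of_int (2 ^ m)" using assms(2) by (simp only: of_int_le_iff)
  also have "\<dots> = 2 ^ m" by simp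
  also have "\<dots> \<le> ((5/4) ^ 4) ^ m" by (intro power_mono) (auto simp: power_divide)
  also have "\<dots> = (5/4) powr real (4 * m)" by (simp only: powr_realpow power_mult)
  finally have "log (5/4) (real_of_int y) \<le> real (4 * m)"
    using assms(1) by (subst log_le_iff) auto
  then show ?thesis unfolding log_scale_def by linarith
qed

lemma fifty_one_square_le_power: "n \<ge> 14 \<Longrightarrow> 51 * n ^ 2 \<le> (2::nat) ^ n"
proof (induction n rule: dec_induct)
  case (step n)
  have "14 * n \<le> n ^ 2" using mult_le_mono1[OF step(1), of n] by (simp add: power2_eq_square)
  then have "2 * n + 1 \<le> n ^ 2" using step(1) by linarith
  moreover have "(Suc n) ^ 2 = n ^ 2 + (2 * n + 1)" by (simp add: power2_eq_square)
  moreover have "(2::nat) ^ Suc n = 2 * 2 ^ n" by simp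
  ultimately show ?case using step.IH by linarith
qed simp

text \<open>\<open>L\<close> stands for the binary logarithm of \<open>N\<close>. The threshold
  \<open>51 * L ^ 2\<close> makes half of \<open>k ^ r\<close> at least \<open>25 * L ^ 2\<close>,
  which exceeds the binary logarithm of all accumulated bounds.\<close>

lemma card_le_of_many_columns:
  fixes k L N r :: nat and n :: int and A B :: "nat set"
  assumes k: "2 \<le> k" "k \<le> 5 * L" and n: "n \<noteq> 0" "\<bar>n\<bar> \<le> int N" and N: "N < 2 ^ L" and L: "14 \<le> L"
    and A: "A \<subseteq> {1..N}" and B: "B \<subseteq> {1..N}"
    and pp: "\<And>a b. a \<in> A \<Longrightarrow> b \<in> B \<Longrightarrow> perfect_power k (int a * int b + n)"
    and r: "1 \<le> r" "r \<le> card A" "k ^ (r - 1) < 51 * L ^ 2" "51 * L ^ 2 \<le> k ^ r"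
  shows "card B \<le> 3570 * L ^ 6"
proof -
  have finA: "finite A" "finite B" using A B finite_subset by blast+
  obtain A' where A': "A' \<subseteq> A" "card A' = r" "finite A'"
    using r(2) by (meson finA(1) obtain_subset_with_card_n)
  obtain a where a: "bij_betw a {..<r} A'"
    using ex_bij_betw_nat_finite[OF A'(3)] A'(2) by (auto simp: atLeast0LessThan)
  have aA: "a i \<in> A" if "i < r" for i using a that A'(1) by (auto simp: bij_betw_def)
  have "\<forall>b i. \<exists>y. b \<in> B \<and> i < r \<longrightarrow> (1::int) \<le> y \<and> int (a i) * int b + n = y ^ k"
    using pp aA unfolding perfect_power_def by blast
  then obtain x :: "nat \<Rightarrow> nat \<Rightarrow> int" where
    x: "\<And>b i. b \<in> B \<Longrightarrow> i < r \<Longrightarrow> 1 \<le> x b i \<and> int (a i) * int b + n = x b i ^ k"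
    by metis
  define D where "D = k ^ r"
  define T where "T = D div 2"
  define M :: nat where "M = 2 ^ (2 * L + 1)"
  define Y where "Y = (\<lambda>b i. int (a i) * int b + n)"
  have Y1: "1 \<le> Y b i" if "b \<in> B" "i < r" for b i
    using x[OF that] by (simp add: Y_def)
  have YM: "Y b i \<le> int M" if "b \<in> B" "i < r" for b i
  proof -
    have "a i \<le> N" "b \<le> N" "1 \<le> N" using aA[OF that(2)] that(1) A B by auto
    then have "int (a i) * int b \<le> int N * int N" "int N \<le> int N * int N"
      by (auto intro: mult_mono)
    then have "Y b i \<le> 2 * (int N * int N)" using n(2) by (simp add: Y_def)
    also have "\<dots> \<le> 2 * (2 ^ L * 2 ^ L)"
    proof -
      have "int N \<le> int (2 ^ L)" unfolding of_nat_le_iff using N by simp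
      then have "int N \<le> 2 ^ L" by simp
      then show ?thesis by (intro mult_left_mono mult_mono) auto
    qed
    also have "\<dots> = int M" by (simp add: M_def power_even_eq power2_eq_square)
    finally show ?thesis .
  qed
  have rL: "r \<le> L"
  proof -
    have "(2::nat) ^ (r - 1) \<le> k ^ (r - 1)" using k(1) by (intro power_mono) auto
    also have "\<dots> < 2 ^ L" using r(3) fifty_one_square_le_power[OF L] by simp
    finally show ?thesis by simp
  qed
  have D: "51 * L ^ 2 \<le> D" "D \<le> 255 * L ^ 3"
  proof -
    show "51 * L ^ 2 \<le> D" using r(4) by (simp add: D_def)
    \<comment> \<open>\<open>D\<close> overshoots the threshold by less than a factor
      \<open>k\<close>, and \<open>k \<le> 5 * L\<close> keeps it polynomial in
      \<open>L\<close>.\<close>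
    have "D = k * k ^ (r - 1)" unfolding D_def using r(1) by (cases r) auto
    also have "\<dots> \<le> (5 * L) * (51 * L ^ 2)" using k(2) r(3) by (intro mult_mono) auto
    also have "\<dots> = 255 * L ^ 3" by (simp add: power2_eq_square power3_eq_cube)
    finally show "D \<le> 255 * L ^ 3" .
  qed
  have LL: "14 * L \<le> L ^ 2" using L by (simp add: power2_eq_square)
  have T: "1 \<le> T" "2 * T \<le> D" "25 * L ^ 2 \<le> T" unfolding T_def using D(1) L LL by linarith+
  \<comment> \<open>In binary exponents \<open>14 * T * D ^ 2\<close> costs
    \<open>27 + 9 * L\<close>, because \<open>7 * 255 ^ 3 < 2 ^ 27\<close>, and the square costs
    \<open>(2 * L + 2) * r * 2\<close>. As \<open>r \<le> L\<close>, the total is below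
    \<open>25 * L ^ 2\<close>.\<close>
  have Tbig: "14 * T * D ^ 2 * (M ^ r * 2 ^ r) ^ 2 < 2 ^ T"
  proof -
    have W2: "(M ^ r * 2 ^ r) ^ 2 = 2 ^ ((2 * L + 2) * r * 2)"
    proof -
      have "M * 2 = 2 ^ (2 * L + 2)" by (simp add: M_def)
      then have "M ^ r * 2 ^ r = (2 ^ (2 * L + 2)) ^ r" by (metis power_mult_distrib)
      then show ?thesis by (simp only: power_mult)
    qed
    have "14 * T * D ^ 2 \<le> 7 * D ^ 3" using T(2) by (simp add: power2_eq_square power3_eq_cube)
    also have "\<dots> \<le> 7 * (255 * L ^ 3) ^ 3" using D(2) by (intro mult_left_mono power_mono) auto
    also have "\<dots> = (7 * 255 ^ 3) * L ^ 9" by (simp add: power_mult_distrib flip: power_mult)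
    also have "\<dots> < 2 ^ 27 * (2 ^ L) ^ 9"
      using L by (intro mult_strict_mono power_strict_mono less_exp) auto
    finally have "14 * T * D ^ 2 < 2 ^ (27 + L * 9)" by (simp only: power_add power_mult)
    then have "14 * T * D ^ 2 * (M ^ r * 2 ^ r) ^ 2 < 2 ^ (27 + L * 9) * 2 ^ ((2 * L + 2) * r * 2)"
      unfolding W2 by (intro mult_strict_right_mono) auto
    also have "\<dots> = 2 ^ (27 + L * 9 + (2 * L + 2) * r * 2)" by (simp only: power_add)
    also have "\<dots> \<le> 2 ^ T"
    proof (rule power_increasing)
      have "(2 * L + 2) * r * 2 \<le> (2 * L + 2) * L * 2" using rL by (intro mult_le_mono) auto
      also have "\<dots> = 4 * L ^ 2 + 4 * L" by (simp add: power2_eq_square algebra_simps)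
      finally show "27 + L * 9 + (2 * L + 2) * r * 2 \<le> T" using T(3) LL L by linarith
    qed simp
    finally show ?thesis .
  qed
  \<comment> \<open>Every scale is nondecreasing in \<open>b\<close>, so equal sums force all
    \<open>r\<close> scales to agree. One number of quadratic size in \<open>L\<close> thus replaces
    a vector of scales, which keeps the number of classes polynomial in \<open>L\<close>.\<close>
  define \<psi> where "\<psi> = (\<lambda>b. \<Sum>i<r. log_scale (Y b i))"
  define R where "R = r * (4 * (2 * L + 1))"
  have Ymono: "Y b i \<le> Y b' i" if "b \<le> b'" for b b' i
    using that unfolding Y_def by (simp add: mult_left_mono)
  have same: "log_scale (Y b i) = log_scale (Y b' i)"
    if b: "b \<in> B" "b' \<in> B" "b \<le> b'" "\<psi> b = \<psi> b'" and i: "i < r" for b b' i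
  proof (rule ccontr)
    have mono: "log_scale (Y b j) \<le> log_scale (Y b' j)" if "j < r" for j
      using Y1[OF b(1) that] Ymono[OF b(3)] by (rule log_scale_mono)
    assume "\<not> ?thesis"
    then have "log_scale (Y b i) < log_scale (Y b' i)" using mono[OF i] by simp
    then have "\<psi> b < \<psi> b'"
      unfolding \<psi>_def using mono i by (intro sum_strict_mono_ex1) auto
    then show False using b(4) by simp
  qed
  have ratio: "4 * Y b' i \<le> 5 * Y b i" if "b \<in> B" "b' \<in> B" "\<psi> b = \<psi> b'" "i < r" for b b' i
  proof -
    have "log_scale (Y b i) = log_scale (Y b' i)"
      using same[OF that(1,2) _ that(3,4)] same[OF that(2,1) _ that(3)[symmetric] that(4)] by (metis nat_le_linear)
    then show ?thesis using Y1 that by (intro log_scale_eq_imp_close) auto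
  qed
  have fibre: "card {b \<in> B. \<psi> b = m} \<le> r * D" for m
  proof (cases "{b \<in> B. \<psi> b = m} = {}")
    case True
    then show ?thesis by (simp only: card.empty)
  next
    case False
    show ?thesis unfolding D_def
    proof (rule card_fibre_le[where x = x and a = a and n = n and M = M and T = T])
      show "inj_on a {..<r}" using a by (simp add: bij_betw_def)
      show "a i \<ge> 1" if "i < r" for i using aA[OF that] A by auto
      show "14 * T * (k ^ r)\<^sup>2 * (M ^ r * 2 ^ r)\<^sup>2 < 2 ^ T" using Tbig by (simp add: D_def)
    qed (use False finA(2) k n x ratio YM T D_def in \<open>auto simp: Y_def M_def\<close>)
  qed
  have "\<psi> b \<le> R" if "b \<in> B" for b
  proof -
    have "\<psi> b \<le> (\<Sum>i<r. 4 * (2 * L + 1))"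
      unfolding \<psi>_def using Y1 YM that by (intro sum_mono log_scale_le) (auto simp: M_def)
    then show ?thesis by (simp add: R_def)
  qed
  then have "B = (\<Union>m\<in>{..R}. {b \<in> B. \<psi> b = m})" by auto
  then have "card B \<le> (\<Sum>m\<in>{..R}. card {b \<in> B. \<psi> b = m})" by (metis card_UN_le finite_atMost)
  also have "\<dots> \<le> (R + 1) * (r * D)" using sum_bounded_above[of "{..R}" _ "r * D"] fibre by simp
  also have "\<dots> \<le> (14 * L ^ 2) * (L * (255 * L ^ 3))"
  proof (intro mult_mono)
    have "R \<le> L * (4 * (2 * L + 1))" unfolding R_def using rL by (intro mult_right_mono) auto
    also have "\<dots> = 8 * L ^ 2 + 4 * L" by (simp add: power2_eq_square algebra_simps)
    finally show "R + 1 \<le> 14 * L ^ 2" using LL L by linarith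
  qed (use rL D(2) in auto)
  also have "\<dots> = 3570 * L ^ 6" by (simp add: power_numeral_reduce)
  finally show ?thesis .
qed

section \<open>Small N and the choice of the constants\<close>

text \<open>Passing from \<open>x ^ k\<close> to \<open>(x + 1) ^ k\<close> adds at least
  \<open>x + 1 \<ge> 2\<close>. This excludes \<open>N = 2\<close>, where
  \<open>A = B = {1, 2}\<close> would make both \<open>n + 1\<close> and \<open>n + 2\<close>
  powers.\<close>

lemma no_consecutive_perfect_powers:
  assumes "2 \<le> k" "perfect_power k m" "perfect_power k (m + 1)"
  shows False
proof -
  obtain x y :: int where xy: "1 \<le> x" "m = x ^ k" "1 \<le> y" "m + 1 = y ^ k"
    using assms unfolding perfect_power_def by auto
  obtain j where j: "k = Suc (Suc j)" using assms(1) by (metis Suc_le_D numeral_2_eq_2 Suc_le_mono)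
  have "x < y" using xy power_mono[of y x k] by (cases "x < y") auto
  then have "(x + 1) ^ k \<le> y ^ k" using xy by (intro power_mono) auto
  moreover have "(x + 1) ^ k = x * (x + 1) ^ Suc j + (x + 1) ^ Suc j" by (simp add: j algebra_simps)
  moreover have "x ^ k \<le> x * (x + 1) ^ Suc j"
    unfolding j power_Suc[of x "Suc j"] using xy by (intro mult_left_mono power_mono) auto
  moreover have "x + 1 \<le> (x + 1) ^ Suc j" using xy by (intro self_le_power) auto
  ultimately show False using xy by linarith
qed

theorem theorem2p7:
  "\<exists>L1 L2 :: real. \<forall>(k::nat) (n::int) (N::nat) (A::nat set) (B::nat set).
     k \<ge> 2 \<longrightarrow> 1 \<le> \<bar>n\<bar> \<longrightarrow> \<bar>n\<bar> \<le> int N \<longrightarrow> real k \<le> 5 * ln (real N) \<longrightarrow>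
     A \<subseteq> {1..N} \<longrightarrow> B \<subseteq> {1..N} \<longrightarrow> bipartite_diophantine k n A B \<longrightarrow>
     real (card A) \<le> L1 * ln (ln (real N)) \<or> real (card B) \<le> ln (real N) powr L2"
proof -
  have ln3: "1 < ln (3::real)" using ln_272_gt_1 by (rule less_trans) simp
  \<comment> \<open>The 12 serves for large \<open>N\<close>; the quotient serves for
    \<open>3 \<le> N < 2 ^ 13\<close>, where \<open>card A \<le> 2 ^ 13\<close> and
    \<open>ln (ln N) \<ge> ln (ln 3) > 0\<close>.\<close>
  define L1 where "L1 = max 12 (2 ^ 13 / ln (ln (3::real)))"
  have "real (card A) \<le> L1 * ln (ln (real N)) \<or> real (card B) \<le> ln (real N) powr 12"
    if k: "k \<ge> 2" and n: "1 \<le> \<bar>n\<bar>" "\<bar>n\<bar> \<le> int N" and kN: "real k \<le> 5 * ln (real N)"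
      and A: "A \<subseteq> {1..N}" and B: "B \<subseteq> {1..N}" and bd: "bipartite_diophantine k n A B"
    for k :: nat and n :: int and N :: nat and A B :: "nat set"
  proof -
    have fin: "finite A" "finite B" using A B finite_subset by blast+
    have pp: "\<And>a b. a \<in> A \<Longrightarrow> b \<in> B \<Longrightarrow> perfect_power k (int a * int b + n)"
      and two: "2 \<le> card A" "2 \<le> card B"
      using bd fin unfolding bipartite_diophantine_def by auto
    have cA: "card A \<le> N" using card_mono[OF _ A] by simp
    \<comment> \<open>From \<open>2 ^ 13\<close> on, \<open>ln N \<ge> 13 * (2/3) > 8\<close>, and
      \<open>L\<close> is at least 14.\<close>
    consider "N \<le> 2" | "3 \<le> N" "N < 2 ^ 13" | "2 ^ 13 \<le> N" by linarith
    then show ?thesis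
    proof cases
      case 1
      then have "N = 2" using cA two by simp
      then have "A \<subseteq> {1, 2}" "B \<subseteq> {1, 2}" using A B by auto
      then have "A = {1, 2}" "B = {1, 2}" using two by (simp_all add: card_seteq)
      then have "perfect_power k (1 + n)" "perfect_power k ((1 + n) + 1)"
        using pp[of 1 1] pp[of 1 2] by (auto simp: algebra_simps)
      then show ?thesis using no_consecutive_perfect_powers[OF k] by blast
    next
      case 2
      have "real (card A) \<le> real (2 ^ 13)" unfolding of_nat_le_iff using cA 2(2) by simp
      then have "real (card A) \<le> 2 ^ 13" by simp
      also have "\<dots> = 2 ^ 13 / ln (ln 3) * ln (ln 3)" using ln3 by simp
      also have "\<dots> \<le> L1 * ln (ln (real N))"
        using ln3 2(1) by (intro mult_mono) (auto simp: L1_def)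
      finally show ?thesis by simp
    next
      case 3
      obtain L0 where L0: "2 ^ L0 \<le> N" "N < 2 ^ (L0 + 1)"
        using ex_power_ivl1[of 2 N] 3 by auto
      define L where "L = L0 + 1"
      have "(2::nat) ^ 13 < 2 ^ (L0 + 1)" using 3 L0(2) by simp
      then have L: "14 \<le> L" unfolding L_def by (subst (asm) power_strict_increasing_iff) auto
      define \<Lambda> where "\<Lambda> = ln (real N)"
      have "real (2 ^ L0) \<le> real N" "real N \<le> real (2 ^ L)"
        unfolding of_nat_le_iff L_def using L0 by auto
      then have N2: "2 ^ L0 \<le> real N" "real N \<le> 2 ^ L" by simp_all
      have "real L0 * ln 2 = ln (2 ^ L0)" by (simp add: ln_realpow)
      also have "\<dots> \<le> \<Lambda>"
        unfolding \<Lambda>_def using N2(1) 3 by (intro ln_mono) auto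
      finally have lam: "real L0 * ln 2 \<le> \<Lambda>" .
      have "real L0 * (2/3) \<le> real L0 * ln 2" using ln2_ge_two_thirds by (intro mult_left_mono) auto
      then have "real L0 * (2/3) \<le> \<Lambda>" using lam by linarith
      moreover have "real L = real L0 + 1" "14 \<le> real L" using L by (simp_all add: L_def)
      ultimately have lamL: "real L \<le> 2 * \<Lambda>" "8 \<le> \<Lambda>" by linarith+
      have "\<Lambda> \<le> ln (2 ^ L)"
        unfolding \<Lambda>_def using N2(2) 3 by (intro ln_mono) auto
      also have "\<dots> = real L * ln 2" by (simp add: ln_realpow)
      also have "\<dots> \<le> real L * 1" using ln_le_minus_one[of "2::real"] by (intro mult_left_mono) auto
      finally have "\<Lambda> \<le> real L" by simp
      then have kL: "k \<le> 5 * L" using kN unfolding \<Lambda>_def[symmetric] by linarith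
      define r where "r = (LEAST j. 51 * L ^ 2 \<le> k ^ j)"
      have "51 * L ^ 2 \<le> k ^ (51 * L ^ 2)"
        using k by (intro less_imp_le power_gt_expt) simp
      then have r1: "51 * L ^ 2 \<le> k ^ r" unfolding r_def by (rule LeastI)
      have r0: "1 \<le> r"
      proof (rule ccontr)
        assume "\<not> 1 \<le> r"
        then have "r = 0" by simp
        then have "51 * L ^ 2 \<le> 1" using r1 by simp
        then show False using mult_le_mono[OF L L] by (simp add: power2_eq_square)
      qed
      have r2: "k ^ (r - 1) < 51 * L ^ 2"
        using not_less_Least[of "r - 1" "\<lambda>j. 51 * L ^ 2 \<le> k ^ j"] r0 by (simp add: r_def[symmetric])
      have loglog: "1 \<le> ln \<Lambda>"
        using ln_272_gt_1 lamL(2) ln_le_cancel_iff[of "272/100" \<Lambda>] by linarith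
      have "(2::nat) ^ (r - 1) \<le> k ^ (r - 1)" using k by (intro power_mono) auto
      then have "2 ^ (r - 1) \<le> 51 * L ^ 2" using r2 by simp
      then have "real (2 ^ (r - 1)) \<le> real (51 * L ^ 2)" by (simp only: of_nat_le_iff)
      then have "2 ^ (r - 1) \<le> 51 * (real L) ^ 2" by simp
      also have "\<dots> \<le> 51 * (2 * \<Lambda>) ^ 2" using lamL by (intro mult_left_mono power_mono) auto
      \<comment> \<open>Since \<open>51 * 4 = 204\<close> is below \<open>2 ^ 8\<close> and
        \<open>2 \<le> 3 * ln 2\<close>, logarithms give
        \<open>r - 1 \<le> 8 + 3 * ln \<Lambda>\<close>; then \<open>ln \<Lambda> \<ge> 1\<close>
        turns \<open>9 + 3 * ln \<Lambda>\<close> into the 12 of \<open>L1\<close>.\<close>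
      also have "\<dots> \<le> 2 ^ 8 * \<Lambda> ^ 2" by (simp add: power2_eq_square)
      finally have "ln (2 ^ (r - 1)) \<le> ln (2 ^ 8 * \<Lambda> ^ 2)"
        using lamL(2) by (subst ln_le_cancel_iff) auto
      then have "real (r - 1) * ln 2 \<le> 8 * ln 2 + 2 * ln \<Lambda>"
        using lamL(2) ln_realpow[of "2::real" 8] by (simp add: ln_mult ln_realpow)
      also have "2 * ln \<Lambda> \<le> 3 * ln \<Lambda> * ln 2"
        using mult_left_mono[OF ln2_ge_two_thirds, of "3 * ln \<Lambda>"] loglog by simp
      finally have "real (r - 1) * ln 2 \<le> (8 + 3 * ln \<Lambda>) * ln 2" by (simp add: algebra_simps)
      then have "real (r - 1) \<le> 8 + 3 * ln \<Lambda>" by simp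
      then have rle: "real r \<le> 12 * ln \<Lambda>" using r0 loglog by (simp add: of_nat_diff)
      show ?thesis
      proof (cases "real (card A) \<le> L1 * ln (ln (real N))")
        case False
        have "12 * ln \<Lambda> \<le> L1 * ln \<Lambda>" using loglog by (intro mult_right_mono) (auto simp: L1_def)
        then have "r \<le> card A" using False rle by (simp add: \<Lambda>_def)
        then have "card B \<le> 3570 * L ^ 6"
          using k kL n L0(2) L A B pp r0 r1 r2
          by (intro card_le_of_many_columns[of k L n N A B r]) (auto simp: L_def)
        then have "real (card B) \<le> real (3570 * L ^ 6)" by (simp only: of_nat_le_iff)
        also have "\<dots> = 3570 * real L ^ 6" by simp
        also have "\<dots> \<le> 3570 * (2 * \<Lambda>) ^ 6" using lamL by (intro mult_left_mono power_mono) auto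
        \<comment> \<open>\<open>3570 * 2 ^ 6 = 228480\<close> is below
          \<open>8 ^ 6 = 262144\<close>, and \<open>\<Lambda> \<ge> 8\<close> then trades
          \<open>8 ^ 6\<close> for \<open>\<Lambda> ^ 6\<close>; hence the exponent 12.\<close>
        also have "\<dots> \<le> 8 ^ 6 * \<Lambda> ^ 6" by (simp add: power_mult_distrib)
        also have "\<dots> \<le> \<Lambda> ^ 6 * \<Lambda> ^ 6" using lamL by (intro mult_right_mono power_mono) auto
        also have "\<dots> = \<Lambda> powr 12" using lamL by (simp flip: power_add)
        finally show ?thesis by (simp add: \<Lambda>_def)
      qed simp
    qed
  qed
  then show ?thesis by blast
qed

end
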